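(* Let $t\le1$, let $\Omega\subset\mathbb R^3$ be an open set, and let $$\mathbf Q(\mathbf x) = \sum_{i=1}^3 q_i(\mathbf x)\,\mathbf E_i,\qquad \mathbf x\in\Omega,$$ where $$\mathbf E_1=\sqrt{\tfrac32}\bigl(\mathbf e_z\otimes\mathbf e_z-\tfrac13\mathbf I\bigr),\quad \mathbf E_2=\sqrt{\tfrac12}\bigl(\mathbf e_x\otimes\mathbf e_x-\mathbf e_y\otimes\mathbf e_y\bigr),\quad \mathbf E_3=\sqrt{\tfrac12}\bigl(\mathbf e_x\otimes\mathbf e_y+\mathbf e_y\otimes\mathbf e_x\bigr),$$ with $q_1,q_2,q_3$ real-valued functions. If $\mathbf Q$ is a uniaxial solution in $\Omega$ of $$\Delta \mathbf{Q}_{ij} = t\,\mathbf{Q}_{ij} - 3\sqrt6\Bigl(\mathbf{Q}_{ik}\mathbf{Q}_{kj}-\tfrac13\delta_{ij}\,\mathrm{tr}(\mathbf{Q}^2)\Bigr)+2\,\mathbf{Q}_{ij}\,\mathrm{tr}(\mathbf{Q}^2),\qquad i,j=1,2,3,$$ then $\mathbf Q$ has a constant eigenframe in every connected component of $\{\mathbf x\in\Omega:\mathbf Q(\mathbf x)\neq0\}$. Moreover, if $\Omega$ is connected, then $\mathbf Q$ has a constant eigenframe in the whole domain $\Omega$.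
   Context: Here $\mathbf e_x=(1,0,0)$, $\mathbf e_y=(0,1,0)$, $\mathbf e_z=(0,0,1)$, $\mathbf I$ is the $3\times3$ identity, repeated indices are summed, and solutions are classical. $\mathbf Q$ is uniaxial if at every point it can be written as $\mathbf Q=s(\mathbf n\otimes\mathbf n-\frac13\mathbf I)$ with $s\in\mathbb R$ and $\mathbf n$ a unit vector ($s=0$ allowed); equivalently $(\mathrm{tr}(\mathbf Q^2))^3=6(\mathrm{tr}(\mathbf Q^3))^2$ at every point. "$\mathbf Q$ has a constant eigenframe in a set $U$" means that there is a fixed orthonormal basis of $\mathbb R^3$, independent of $\mathbf x$, consisting of eigenvectors of $\mathbf Q(\mathbf x)$ for every $\mathbf x\in U$. The real number $t$ is the reduced temperature. *)

theory Defs
  imports "HOL-Analysis.Analysis"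
begin

definition tensor_prod :: "real^3 \<Rightarrow> real^3 \<Rightarrow> real^3^3" (infixl "\<otimes>" 75) where
  "u \<otimes> v = (\<chi> i j. u $ i * v $ j)"

abbreviation e\<^sub>x :: "real^3" where "e\<^sub>x \<equiv> axis 1 1"
abbreviation e\<^sub>y :: "real^3" where "e\<^sub>y \<equiv> axis 2 1"
abbreviation e\<^sub>z :: "real^3" where "e\<^sub>z \<equiv> axis 3 1"

definition E\<^sub>1 :: "real^3^3" where
  "E\<^sub>1 = sqrt (3/2) *\<^sub>R (e\<^sub>z \<otimes> e\<^sub>z - (1/3) *\<^sub>R mat 1)"

definition E\<^sub>2 :: "real^3^3" where
  "E\<^sub>2 = sqrt (1/2) *\<^sub>R (e\<^sub>x \<otimes> e\<^sub>x - e\<^sub>y \<otimes> e\<^sub>y)"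

definition E\<^sub>3 :: "real^3^3" where
  "E\<^sub>3 = sqrt (1/2) *\<^sub>R (e\<^sub>x \<otimes> e\<^sub>y + e\<^sub>y \<otimes> e\<^sub>x)"

definition partial_deriv :: "3 \<Rightarrow> (real^3 \<Rightarrow> real) \<Rightarrow> real^3 \<Rightarrow> real" where
  "partial_deriv i f x = frechet_derivative f (at x) (axis i 1)"

definition laplacian :: "(real^3 \<Rightarrow> real) \<Rightarrow> real^3 \<Rightarrow> real" where
  "laplacian f x = (\<Sum>i\<in>UNIV. partial_deriv i (partial_deriv i f) x)"

text \<open>The class \<open>C\<^sup>k(S)\<close>, intended for open \<open>S\<close>. On an open set, requiring Frechet
  differentiability at each step agrees with requiring only that all partial derivatives up to
  order \<open>k\<close> exist and are continuous.\<close>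

fun Ck_on :: "nat \<Rightarrow> (real^3) set \<Rightarrow> (real^3 \<Rightarrow> real) \<Rightarrow> bool" where
  "Ck_on 0 S f \<longleftrightarrow> continuous_on S f"
| "Ck_on (Suc k) S f \<longleftrightarrow>
     (\<forall>x\<in>S. f differentiable at x) \<and> (\<forall>i. Ck_on k S (partial_deriv i f))"

text \<open>Classical (\<open>C\<^sup>2\<close>) solutions of the Euler--Lagrange system at reduced temperature \<open>t\<close>.\<close>

definition classical_solution :: "real \<Rightarrow> (real^3) set \<Rightarrow> (real^3 \<Rightarrow> real^3^3) \<Rightarrow> bool" where
  "classical_solution t S Q \<longleftrightarrow>
     (\<forall>i j. Ck_on 2 S (\<lambda>x. Q x $ i $ j)) \<and>
     (\<forall>x\<in>S. \<forall>i j.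
        laplacian (\<lambda>y. Q y $ i $ j) x =
          t * Q x $ i $ j
          - 3 * sqrt 6 * ((\<Sum>k\<in>UNIV. Q x $ i $ k * Q x $ k $ j)
                          - (1/3) * (if i = j then 1 else 0) * trace (Q x ** Q x))
          + 2 * Q x $ i $ j * trace (Q x ** Q x))"

definition uniaxial_on :: "(real^3) set \<Rightarrow> (real^3 \<Rightarrow> real^3^3) \<Rightarrow> bool" where
  "uniaxial_on S Q \<longleftrightarrow>
     (\<forall>x\<in>S. \<exists>s n. norm n = 1 \<and> Q x = s *\<^sub>R (n \<otimes> n - (1/3) *\<^sub>R mat 1))"

definition constant_eigenframe :: "(real^3 \<Rightarrow> real^3^3) \<Rightarrow> (real^3) set \<Rightarrow> bool" where
  "constant_eigenframe Q U \<longleftrightarrow>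
     (\<exists>B. pairwise orthogonal B \<and> (\<forall>v\<in>B. norm v = 1) \<and> span B = UNIV \<and>
          (\<forall>x\<in>U. \<forall>v\<in>B. \<exists>l. Q x *v v = l *\<^sub>R v))"

end

theory Submission
  imports Defs
begin

text \<open>
  Put \<open>c = Q\<^sub>3\<^sub>3\<close>, \<open>d = (Q\<^sub>1\<^sub>1 - Q\<^sub>2\<^sub>2)/2\<close>, \<open>e = Q\<^sub>1\<^sub>2\<close>. These three functions
  determine \<open>Q\<close>, and the direction of \<open>(d, e)\<close> fixes the frame in the horizontal plane. Uniaxiality
  says that at each point the director is vertical, \<open>d = e = 0\<close>, or horizontal,
  \<open>d\<^sup>2 + e\<^sup>2 = 9/4 c\<^sup>2\<close> (\<open>uniaxial_dichotomy\<close>). Both can hold only where \<open>Q = 0\<close>,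
  and both are closed conditions, so exactly one of them holds throughout a component of
  \<open>{Q \<noteq> 0}\<close>.

  For a vertical director the coordinate axes are an eigenframe. For a horizontal director all three
  functions solve one linear equation \<open>\<Delta>f = V f\<close> with a continuous potential \<open>V\<close>
  (\<open>euler_lagrange_components\<close>). The constraint describes a cone, and the Laplacian of the
  constraint leaves no room for the direction of \<open>(d, e)\<close> to vary
  (\<open>proportional_on_connected\<close>): \<open>d = \<alpha> c\<close> and \<open>e = \<beta> c\<close> with constants.
  This settles the components.

  On a connected domain the frames of different components have to be matched across the zero set of
  \<open>Q\<close>. Here one uses that a solution of \<open>\<Delta>w = V w\<close> that vanishes on a nonempty open
  set vanishes identically (\<open>weak_unique_continuation\<close>). The functions \<open>d\<close> and \<open>e\<close>
  solve such an equation in all of \<open>\<Omega>\<close>, so one vertical component makes both vanish everywhere.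
  Without vertical components \<open>c\<close> solves the equation in \<open>\<Omega>\<close>, too, and
  \<open>d - \<alpha> c\<close> and \<open>e - \<beta> c\<close>, which vanish on one component, vanish everywhere.

  Unique continuation is proved with a Carleman estimate for a quadratic weight
  (\<open>carleman_estimate\<close>). Such weights have constant Hessians, so the commutator computation is a
  pointwise identity up to a divergence, and they suffice to continue across a sphere
  (\<open>touching_ball_weight\<close>, \<open>unique_continuation_touching_ball\<close>).
\<close>

section \<open>Functions with two continuous derivatives\<close>

text \<open>
  Applied to the derivative of a vector field this is the divergence, and applied to a Hessian it is
  the Laplacian; both are then free of coordinates.
\<close>

definition lin_trace :: "('a::euclidean_space \<Rightarrow> 'a) \<Rightarrow> real" where
  "lin_trace T = (\<Sum>b\<in>Basis. T b \<bullet> b)"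

text \<open>
  The gradient \<open>g\<close> and the Hessian \<open>H\<close>, a linear map at each point, are carried
  along explicitly: every function differentiated below is built by sums, products and compositions,
  so its derivatives are known as terms.
\<close>

definition C2_on :: "'a::euclidean_space set \<Rightarrow> ('a \<Rightarrow> real) \<Rightarrow> ('a \<Rightarrow> 'a) \<Rightarrow> ('a \<Rightarrow> 'a \<Rightarrow> 'a) \<Rightarrow> bool" where
  "C2_on S f g H \<longleftrightarrow>
     (\<forall>x\<in>S. (f has_derivative (\<lambda>h. g x \<bullet> h)) (at x) \<and> (g has_derivative H x) (at x)) \<and>
     (\<forall>h. continuous_on S (\<lambda>x. H x h))"

text \<open>
  Two applications of the mean value theorem, first along \<open>h\<close> and then along \<open>k\<close>, turn
  the symmetric second difference into a value of the Hessian.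
\<close>

lemma second_difference_mvt:
  fixes f :: "'a::euclidean_space \<Rightarrow> real"
  assumes f: "C2_on S f g H" and s: "0 < s"
    and S: "\<And>a b. 0 \<le> a \<Longrightarrow> a \<le> s \<Longrightarrow> 0 \<le> b \<Longrightarrow> b \<le> s \<Longrightarrow> x + a *\<^sub>R h + b *\<^sub>R k \<in> S"
  shows "\<exists>a b. 0 \<le> a \<and> a \<le> s \<and> 0 \<le> b \<and> b \<le> s \<and>
    f (x + s *\<^sub>R h + s *\<^sub>R k) - f (x + s *\<^sub>R h) - f (x + s *\<^sub>R k) + f x
      = s\<^sup>2 * (H (x + a *\<^sub>R h + b *\<^sub>R k) k \<bullet> h)"
proof -
  have df: "(f has_derivative (\<lambda>h. g y \<bullet> h)) (at y)" if "y \<in> S" for y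
    using f that unfolding C2_on_def by auto
  have dg: "(g has_derivative H y) (at y)" if "y \<in> S" for y
    using f that unfolding C2_on_def by auto
  define \<phi> where "\<phi> a = f (x + a *\<^sub>R h + s *\<^sub>R k) - f (x + a *\<^sub>R h)" for a
  have d\<phi>: "(\<phi> has_real_derivative (g (x + a *\<^sub>R h + s *\<^sub>R k) \<bullet> h - g (x + a *\<^sub>R h) \<bullet> h)) (at a)"
    if "0 \<le> a" "a \<le> s" for a
  proof -
    have 1: "(f has_derivative (\<lambda>h'. g (x + a *\<^sub>R h + s *\<^sub>R k) \<bullet> h')) (at (x + a *\<^sub>R h + s *\<^sub>R k))"
      by (rule df) (use S that s in auto)
    have 2: "(f has_derivative (\<lambda>h'. g (x + a *\<^sub>R h) \<bullet> h')) (at (x + a *\<^sub>R h))"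
      by (rule df) (use S[of a 0] that s in auto)
    have 3: "((\<lambda>a. x + a *\<^sub>R h + s *\<^sub>R k) has_derivative (\<lambda>t. t *\<^sub>R h)) (at a)"
      by (auto intro!: derivative_eq_intros)
    have 4: "((\<lambda>a. x + a *\<^sub>R h) has_derivative (\<lambda>t. t *\<^sub>R h)) (at a)"
      by (auto intro!: derivative_eq_intros)
    have 5: "((\<lambda>a. f (x + a *\<^sub>R h + s *\<^sub>R k)) has_derivative (\<lambda>t. g (x + a *\<^sub>R h + s *\<^sub>R k) \<bullet> (t *\<^sub>R h))) (at a)"
      using has_derivative_compose[OF 3 1] by simp
    have 6: "((\<lambda>a. f (x + a *\<^sub>R h)) has_derivative (\<lambda>t. g (x + a *\<^sub>R h) \<bullet> (t *\<^sub>R h))) (at a)"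
      using has_derivative_compose[OF 4 2] by simp
    show ?thesis
      unfolding has_field_derivative_def \<phi>_def
      by (rule has_derivative_eq_rhs[OF has_derivative_diff[OF 5 6]]) (auto simp: algebra_simps)
  qed
  obtain a where a: "0 < a" "a < s" and
    ea: "\<phi> s - \<phi> 0 = (s - 0) * (g (x + a *\<^sub>R h + s *\<^sub>R k) \<bullet> h - g (x + a *\<^sub>R h) \<bullet> h)"
    using MVT2[OF s d\<phi>] by auto
  define \<psi> where "\<psi> b = g (x + a *\<^sub>R h + b *\<^sub>R k) \<bullet> h" for b
  have d\<psi>: "(\<psi> has_real_derivative (H (x + a *\<^sub>R h + b *\<^sub>R k) k \<bullet> h)) (at b)"
    if "0 \<le> b" "b \<le> s" for b
  proof -
    have 1: "(g has_derivative H (x + a *\<^sub>R h + b *\<^sub>R k)) (at (x + a *\<^sub>R h + b *\<^sub>R k))"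
      by (rule dg) (use S that a in auto)
    have 3: "((\<lambda>b. x + a *\<^sub>R h + b *\<^sub>R k) has_derivative (\<lambda>t. t *\<^sub>R k)) (at b)"
      by (auto intro!: derivative_eq_intros)
    have 5: "((\<lambda>b. g (x + a *\<^sub>R h + b *\<^sub>R k)) has_derivative (\<lambda>t. H (x + a *\<^sub>R h + b *\<^sub>R k) (t *\<^sub>R k))) (at b)"
      using has_derivative_compose[OF 3 1] by simp
    show ?thesis
      unfolding has_field_derivative_def \<psi>_def
      by (rule has_derivative_eq_rhs[OF has_derivative_inner_left[OF 5, of h]])
         (auto simp: linear_cmul[OF has_derivative_linear[OF 1]])
  qed
  obtain b where b: "0 < b" "b < s" and
    eb: "\<psi> s - \<psi> 0 = (s - 0) * (H (x + a *\<^sub>R h + b *\<^sub>R k) k \<bullet> h)"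
    using MVT2[OF s d\<psi>] by auto
  have "f (x + s *\<^sub>R h + s *\<^sub>R k) - f (x + s *\<^sub>R h) - f (x + s *\<^sub>R k) + f x = s * (\<psi> s - \<psi> 0)"
    using ea by (simp add: \<phi>_def \<psi>_def)
  also have "\<dots> = s\<^sup>2 * (H (x + a *\<^sub>R h + b *\<^sub>R k) k \<bullet> h)"
    using eb by (simp add: power2_eq_square)
  finally show ?thesis using a b by (intro exI[of _ a] exI[of _ b]) auto
qed

text \<open>
  The second difference is symmetric in \<open>h\<close> and \<open>k\<close>, so the mean value form of
  both orders agrees at two points that tend to \<open>x\<close>; continuity of the Hessian gives the limit.
\<close>

lemma hessian_symmetric:
  fixes f :: "'a::euclidean_space \<Rightarrow> real"
  assumes f: "C2_on S f g H" and S: "open S" and x: "x \<in> S"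
  shows "H x h \<bullet> k = H x k \<bullet> h"
proof -
  have cont: "((\<lambda>y. H y h) \<longlongrightarrow> H x h) (at x)" for h
    using f S x unfolding C2_on_def by (auto simp: continuous_on_eq_continuous_at isCont_def)
  obtain e where e: "0 < e" "ball x e \<subseteq> S"
    using S x by (meson openE)
  define B where "B = norm h + norm k + 1"
  have B: "0 < B" "B \<ge> norm h + norm k" by (auto simp: B_def add_nonneg_pos)
  define s where "s n = (e / B) * inverse (real (Suc n) + 1)" for n
  have s: "0 < s n" "s n * B < e" for n
  proof -
    show "0 < s n" using e B by (auto simp: s_def)
    have "s n * B = e * inverse (real (Suc n) + 1)" using B by (simp add: s_def)
    also have "\<dots> < e * 1"
      using e by (intro mult_strict_left_mono) (auto simp: field_simps)
    finally show "s n * B < e" by simp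
  qed
  have s0: "s \<longlonglongrightarrow> 0"
  proof -
    have "(\<lambda>n. (e/B) * inverse (real (Suc n))) \<longlonglongrightarrow> (e/B) * 0"
      by (intro tendsto_mult tendsto_const LIMSEQ_inverse_real_of_nat)
    then have "(\<lambda>n. (e/B) * inverse (real (Suc (Suc n)))) \<longlonglongrightarrow> (e/B) * 0"
      by (rule LIMSEQ_Suc)
    then show ?thesis by (simp add: s_def[abs_def] add_ac)
  qed
  have near: "norm (a *\<^sub>R u + b *\<^sub>R v) \<le> s n * B"
    if "0 \<le> a" "a \<le> s n" "0 \<le> b" "b \<le> s n" "norm u + norm v \<le> B" for a b n and u v :: 'a
  proof -
    have "norm (a *\<^sub>R u + b *\<^sub>R v) \<le> a * norm u + b * norm v"
      using that norm_triangle_ineq[of "a *\<^sub>R u" "b *\<^sub>R v"] by simp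
    also have "\<dots> \<le> s n * norm u + s n * norm v"
      using that by (intro add_mono mult_right_mono) auto
    also have "\<dots> \<le> s n * B"
      using that s[of n] by (simp add: distrib_left[symmetric])
    finally show ?thesis .
  qed
  have inS: "x + a *\<^sub>R u + b *\<^sub>R v \<in> S"
    if "0 \<le> a" "a \<le> s n" "0 \<le> b" "b \<le> s n" "norm u + norm v \<le> B" for a b n and u v :: 'a
    using near[OF that] s[of n] e
    by (auto simp: subset_iff dist_norm add.assoc norm_minus_commute)
  have "\<exists>y z. norm (y - x) \<le> s n * B \<and> norm (z - x) \<le> s n * B \<and> H y k \<bullet> h = H z h \<bullet> k" for n
  proof -
    have "0 < s n" using s by auto
    obtain a b where ab: "0 \<le> a" "a \<le> s n" "0 \<le> b" "b \<le> s n" and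
      1: "f (x + s n *\<^sub>R h + s n *\<^sub>R k) - f (x + s n *\<^sub>R h) - f (x + s n *\<^sub>R k) + f x
      = (s n)\<^sup>2 * (H (x + a *\<^sub>R h + b *\<^sub>R k) k \<bullet> h)"
      using second_difference_mvt[OF f \<open>0 < s n\<close>, of x h k] inS[of _ n _ h k] B by blast
    obtain a' b' where ab': "0 \<le> a'" "a' \<le> s n" "0 \<le> b'" "b' \<le> s n" and
      2: "f (x + s n *\<^sub>R k + s n *\<^sub>R h) - f (x + s n *\<^sub>R k) - f (x + s n *\<^sub>R h) + f x
      = (s n)\<^sup>2 * (H (x + a' *\<^sub>R k + b' *\<^sub>R h) h \<bullet> k)"
      using second_difference_mvt[OF f \<open>0 < s n\<close>, of x k h] inS[of _ n _ k h] B by force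
    have "(s n)\<^sup>2 * (H (x + a *\<^sub>R h + b *\<^sub>R k) k \<bullet> h) = (s n)\<^sup>2 * (H (x + a' *\<^sub>R k + b' *\<^sub>R h) h \<bullet> k)"
      unfolding 1[symmetric] 2[symmetric] by (simp add: add_ac)
    then have "H (x + a *\<^sub>R h + b *\<^sub>R k) k \<bullet> h = H (x + a' *\<^sub>R k + b' *\<^sub>R h) h \<bullet> k"
      using \<open>0 < s n\<close> by simp
    then show ?thesis
      using near[OF ab, of h k] near[OF ab', of k h] B
      by (intro exI[of _ "x + a *\<^sub>R h + b *\<^sub>R k"] exI[of _ "x + a' *\<^sub>R k + b' *\<^sub>R h"])
         (auto simp: add.assoc)
  qed
  then obtain y z where y: "\<And>n. norm (y n - x) \<le> s n * B" and z: "\<And>n. norm (z n - x) \<le> s n * B"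
    and eq: "\<And>n. H (y n) k \<bullet> h = H (z n) h \<bullet> k"
    by metis
  have sB: "(\<lambda>n. s n * B) \<longlonglongrightarrow> 0" using tendsto_mult_left_zero[OF s0] .
  have "y \<longlonglongrightarrow> x"
    by (rule LIM_zero_cancel, rule Lim_null_comparison[OF _ sB]) (use y in auto)
  moreover have "z \<longlonglongrightarrow> x"
    by (rule LIM_zero_cancel, rule Lim_null_comparison[OF _ sB]) (use z in auto)
  ultimately have "(\<lambda>n. H (y n) k) \<longlonglongrightarrow> H x k" "(\<lambda>n. H (z n) h) \<longlonglongrightarrow> H x h"
    using cont by (auto intro!: isCont_tendsto_compose[of x "\<lambda>y. H y k"] isCont_tendsto_compose[of x "\<lambda>y. H y h"] simp: isCont_def)
  then have "(\<lambda>n. H (y n) k \<bullet> h) \<longlonglongrightarrow> H x k \<bullet> h" "(\<lambda>n. H (z n) h \<bullet> k) \<longlonglongrightarrow> H x h \<bullet> k"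
    by (auto intro!: tendsto_inner)
  then show ?thesis unfolding eq using LIMSEQ_unique by blast
qed

section \<open>The divergence theorem for compact support\<close>

lemma integrable_continuous_compact_support:
  fixes f :: "'a::euclidean_space \<Rightarrow> real"
  assumes "continuous_on UNIV f" "compact K" "\<And>x. x \<notin> K \<Longrightarrow> f x = 0"
  shows "integrable lborel f"
proof -
  have "integrable lborel (\<lambda>x. indicator K x *\<^sub>R f x)"
    using assms by (intro borel_integrable_compact) (auto intro: continuous_on_subset)
  moreover have "(\<lambda>x. indicator K x *\<^sub>R f x) = f"
    using assms by (auto simp: indicator_def fun_eq_iff)
  ultimately show ?thesis by simp
qed

lemma has_derivative_zero_outside:
  fixes F :: "'a::euclidean_space \<Rightarrow> 'b::euclidean_space"
  assumes F: "(F has_derivative F') (at x)" and U: "open U" "x \<in> U" "\<And>y. y \<in> U \<Longrightarrow> F y = 0"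
  shows "F' = (\<lambda>h. 0)"
proof -
  have "(F has_derivative (\<lambda>h. 0)) (at x)"
    by (rule has_derivative_transform_within_open[OF has_derivative_const U(1,2), of 0])
       (use U in auto)
  with F show ?thesis by (rule has_derivative_unique)
qed

text \<open>
  Lebesgue measure is translation invariant, so every difference quotient of \<open>f\<close> in direction
  \<open>b\<close> has integral zero; dominated convergence passes this to the derivative.
\<close>

lemma integral_directional_derivative_zero:
  fixes f :: "'a::euclidean_space \<Rightarrow> real"
  assumes df: "\<And>x. (f has_derivative f' x) (at x)"
    and cont: "continuous_on UNIV (\<lambda>x. f' x b)"
    and K: "compact K" "\<And>x. x \<notin> K \<Longrightarrow> f x = 0"
  shows "integral\<^sup>L lborel (\<lambda>x. f' x b) = 0"
proof -
  have cf: "continuous_on UNIV f"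
    using df by (meson continuous_at_imp_continuous_on has_derivative_continuous)
  have f'0: "f' x b = 0" if "x \<notin> K" for x
    using has_derivative_zero_outside[OF df, of "-K" x] K that
    by (auto simp: compact_imp_closed open_Compl)
  have "bounded ((\<lambda>x. f' x b) ` K)"
    by (intro compact_imp_bounded compact_continuous_image K continuous_on_subset[OF cont]) auto
  then obtain C where C0: "\<And>x. x \<in> K \<Longrightarrow> \<bar>f' x b\<bar> \<le> C" unfolding bounded_iff by auto
  define D where "D = max C 0"
  have D: "\<bar>f' x b\<bar> \<le> D" for x
    using C0[of x] f'0[of x] by (cases "x \<in> K") (auto simp: D_def)
  define s where "s n = inverse (real (Suc n))" for n
  have s: "0 < s n" "s n \<le> 1" for n by (auto simp: s_def field_simps)
  have s0: "s \<longlonglongrightarrow> 0" unfolding s_def[abs_def] by (rule LIMSEQ_inverse_real_of_nat)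
  define L where "L = (\<lambda>(x, t). x - t *\<^sub>R b) ` (K \<times> {0..1::real})"
  have L: "compact L" unfolding L_def
    by (intro compact_continuous_image compact_Times K compact_Icc)
       (auto intro!: continuous_intros simp: case_prod_beta)
  define \<delta> where "\<delta> n x = (f (s n *\<^sub>R b + x) - f x) / s n" for n x
  have dline: "((\<lambda>t. f (x + t *\<^sub>R b)) has_real_derivative f' (x + t *\<^sub>R b) b) (at t)" for x t
  proof -
    have 3: "((\<lambda>t. x + t *\<^sub>R b) has_derivative (\<lambda>t. t *\<^sub>R b)) (at t)"
      by (auto intro!: derivative_eq_intros)
    have "((\<lambda>t. f (x + t *\<^sub>R b)) has_derivative (\<lambda>u. f' (x + t *\<^sub>R b) (u *\<^sub>R b))) (at t)"
      using has_derivative_compose[OF 3 df[of "x + t *\<^sub>R b"]] by simp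
    then show ?thesis unfolding has_field_derivative_def
      by (rule has_derivative_eq_rhs)
         (auto simp: linear_cmul[OF has_derivative_linear[OF df]] mult.commute)
  qed
  have mvt: "\<exists>t. 0 < t \<and> t < s n \<and> \<delta> n x = f' (x + t *\<^sub>R b) b" for n x
  proof -
    have "\<exists>t>0. t < s n \<and> f (x + s n *\<^sub>R b) - f (x + 0 *\<^sub>R b) = (s n - 0) * f' (x + t *\<^sub>R b) b"
      by (rule MVT2) (use s dline in auto)
    then show ?thesis using s[of n] by (auto simp: \<delta>_def add.commute field_simps)
  qed
  have fi: "integrable lborel f"
    by (rule integrable_continuous_compact_support[OF cf K])
  have tr: "integrable lborel (\<lambda>x. f (c + x))" "integral\<^sup>L lborel (\<lambda>x. f (c + x)) = integral\<^sup>L lborel f" for c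
  proof -
    have bm: "f \<in> borel_measurable borel" using cf by (rule borel_measurable_continuous_onI)
    have "integrable (distr lborel borel ((+) c)) f" using fi by (simp add: lborel_distr_plus)
    then show "integrable lborel (\<lambda>x. f (c + x))"
      by (subst (asm) integrable_distr_eq) (use bm in auto)
    have "integral\<^sup>L (distr lborel borel ((+) c)) f = integral\<^sup>L lborel (\<lambda>x. f (c + x))"
      by (rule integral_distr) (use bm in auto)
    then show "integral\<^sup>L lborel (\<lambda>x. f (c + x)) = integral\<^sup>L lborel f"
      by (simp add: lborel_distr_plus)
  qed
  have \<delta>0: "integral\<^sup>L lborel (\<delta> n) = 0" for n
    unfolding \<delta>_def using tr fi by simp
  have bound: "\<bar>\<delta> n x\<bar> \<le> D * indicator L x" for n x
  proof -
    obtain t where t: "0 < t" "t < s n" "\<delta> n x = f' (x + t *\<^sub>R b) b" using mvt by blast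
    show ?thesis
    proof (cases "x \<in> L")
      case True then show ?thesis using t D by auto
    next
      case False
      have "x + t *\<^sub>R b \<notin> K"
      proof
        assume "x + t *\<^sub>R b \<in> K"
        then have "(x + t *\<^sub>R b, t) \<in> K \<times> {0..1}" using t s[of n] by auto
        then have "x \<in> L" unfolding L_def by force
        with False show False by simp
      qed
      then show ?thesis using False t f'0 by simp
    qed
  qed
  have lim: "(\<lambda>n. \<delta> n x) \<longlonglongrightarrow> f' x b" for x
  proof -
    have "((\<lambda>t. (f (x + (0+t) *\<^sub>R b) - f (x + 0 *\<^sub>R b)) / t) \<longlongrightarrow> f' (x + 0 *\<^sub>R b) b) (at 0)"
      using dline[of x 0] unfolding DERIV_def .
    then have "((\<lambda>t. (f (x + t *\<^sub>R b) - f x) / t) \<longlongrightarrow> f' x b) (at 0)" by simp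
    moreover have "filterlim s (at 0) sequentially"
      using s0 s by (auto simp: filterlim_at eventually_sequentially less_imp_neq)
        (metis less_irrefl)
    ultimately have "((\<lambda>n. (f (x + s n *\<^sub>R b) - f x) / s n) \<longlonglongrightarrow> f' x b)"
      by (rule filterlim_compose)
    then show ?thesis by (simp add: \<delta>_def add.commute)
  qed
  have "(\<lambda>n. integral\<^sup>L lborel (\<delta> n)) \<longlonglongrightarrow> integral\<^sup>L lborel (\<lambda>x. f' x b)"
  proof (rule integral_dominated_convergence)
    show "(\<lambda>x. f' x b) \<in> borel_measurable lborel"
      using borel_measurable_continuous_onI[OF cont] by simp
    show "\<delta> n \<in> borel_measurable lborel" for n
    proof -
      have "continuous_on UNIV (\<delta> n)" unfolding \<delta>_def
        using s[of n] by (intro continuous_intros continuous_on_compose2[OF cf]) auto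
      then show ?thesis using borel_measurable_continuous_onI by auto
    qed
    show "integrable lborel (\<lambda>x. D * indicator L x)"
      using borel_integrable_compact[OF L, of "\<lambda>_. D"] by (simp add: mult.commute)
  qed (use bound lim in auto)
  then show ?thesis unfolding \<delta>0 by (simp add: LIMSEQ_const_iff)
qed

lemma integral_divergence_zero:
  fixes F :: "'a::euclidean_space \<Rightarrow> 'a"
  assumes dF: "\<And>x. (F has_derivative F' x) (at x)"
    and cont: "\<And>h. continuous_on UNIV (\<lambda>x. F' x h)"
    and K: "compact K" "\<And>x. x \<notin> K \<Longrightarrow> F x = 0"
  shows "integrable lborel (\<lambda>x. lin_trace (F' x))" "integral\<^sup>L lborel (\<lambda>x. lin_trace (F' x)) = 0"
proof -
  have F'0: "F' x = (\<lambda>h. 0)" if "x \<notin> K" for x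
    using has_derivative_zero_outside[OF dF, of "-K" x] K that
    by (auto simp: compact_imp_closed open_Compl)
  have i: "integrable lborel (\<lambda>x. F' x b \<bullet> b)" for b
    by (rule integrable_continuous_compact_support[OF _ K(1)])
       (auto simp: F'0 intro!: continuous_intros cont)
  have z: "integral\<^sup>L lborel (\<lambda>x. F' x b \<bullet> b) = 0" for b
    by (rule integral_directional_derivative_zero[where f = "\<lambda>x. F x \<bullet> b" and f' = "\<lambda>x h. F' x h \<bullet> b", OF _ _ K(1)])
       (auto simp: K intro!: continuous_intros cont has_derivative_inner_left dF)
  show "integrable lborel (\<lambda>x. lin_trace (F' x))" unfolding lin_trace_def using i by auto
  show "integral\<^sup>L lborel (\<lambda>x. lin_trace (F' x)) = 0" unfolding lin_trace_def
    using i z by (simp add: Bochner_Integration.integral_sum)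
qed

section \<open>Calculus of gradients, Hessians and traces\<close>

lemma C2_onD:
  assumes "C2_on S f g H"
  shows "x \<in> S \<Longrightarrow> (f has_derivative (\<lambda>h. g x \<bullet> h)) (at x)"
    and "x \<in> S \<Longrightarrow> (g has_derivative H x) (at x)"
    and "continuous_on S (\<lambda>x. H x h)"
    and "continuous_on S f" "continuous_on S g"
proof -
  show d1: "(f has_derivative (\<lambda>h. g x \<bullet> h)) (at x)" and d2: "(g has_derivative H x) (at x)"
    if "x \<in> S" for x using assms that by (auto simp: C2_on_def)
  show "continuous_on S (\<lambda>x. H x h)" using assms by (auto simp: C2_on_def)
  show "continuous_on S f" "continuous_on S g"
    using d1 d2 by (meson continuous_at_imp_continuous_on has_derivative_continuous)+
qed

lemma C2_on_subset: "C2_on S f g H \<Longrightarrow> T \<subseteq> S \<Longrightarrow> C2_on T f g H"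
  unfolding C2_on_def by (meson continuous_on_subset subsetD)

lemma C2_on_mult:
  fixes f f' :: "'a::euclidean_space \<Rightarrow> real"
  assumes f: "C2_on S f g H" and f': "C2_on S f' g' H'"
  shows "C2_on S (\<lambda>x. f x * f' x) (\<lambda>x. f x *\<^sub>R g' x + f' x *\<^sub>R g x)
    (\<lambda>x h. (g x \<bullet> h) *\<^sub>R g' x + f x *\<^sub>R H' x h + (g' x \<bullet> h) *\<^sub>R g x + f' x *\<^sub>R H x h)"
  unfolding C2_on_def
proof (intro conjI ballI allI)
  note d = C2_onD[OF f] and d' = C2_onD[OF f']
  fix x assume x: "x \<in> S"
  show "((\<lambda>x. f x * f' x) has_derivative (\<lambda>h. (f x *\<^sub>R g' x + f' x *\<^sub>R g x) \<bullet> h)) (at x)"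
    by (rule has_derivative_eq_rhs[OF has_derivative_mult[OF d(1)[OF x] d'(1)[OF x]]])
       (auto simp: inner_simps algebra_simps)
  show "((\<lambda>x. f x *\<^sub>R g' x + f' x *\<^sub>R g x) has_derivative
    (\<lambda>h. (g x \<bullet> h) *\<^sub>R g' x + f x *\<^sub>R H' x h + (g' x \<bullet> h) *\<^sub>R g x + f' x *\<^sub>R H x h)) (at x)"
    by (rule has_derivative_eq_rhs[OF has_derivative_add[OF has_derivative_scaleR[OF d(1)[OF x] d'(2)[OF x]]
          has_derivative_scaleR[OF d'(1)[OF x] d(2)[OF x]]]]) (auto simp: algebra_simps)
next
  fix h show "continuous_on S (\<lambda>x. (g x \<bullet> h) *\<^sub>R g' x + f x *\<^sub>R H' x h + (g' x \<bullet> h) *\<^sub>R g x + f' x *\<^sub>R H x h)"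
    using C2_onD[OF f] C2_onD[OF f'] by (intro continuous_intros) auto
qed

lemma C2_on_compose:
  fixes f :: "'a::euclidean_space \<Rightarrow> real" and \<psi> :: "real \<Rightarrow> real"
  assumes f: "C2_on S f g H"
    and d1: "\<And>s. (\<psi> has_real_derivative \<psi>' s) (at s)"
    and d2: "\<And>s. (\<psi>' has_real_derivative \<psi>'' s) (at s)"
    and c: "continuous_on UNIV \<psi>''"
  shows "C2_on S (\<lambda>x. \<psi> (f x)) (\<lambda>x. \<psi>' (f x) *\<^sub>R g x)
    (\<lambda>x h. \<psi>'' (f x) *\<^sub>R ((g x \<bullet> h) *\<^sub>R g x) + \<psi>' (f x) *\<^sub>R H x h)"
  unfolding C2_on_def
proof (intro conjI ballI allI)
  note d = C2_onD[OF f]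
  fix x assume x: "x \<in> S"
  show "((\<lambda>x. \<psi> (f x)) has_derivative (\<lambda>h. (\<psi>' (f x) *\<^sub>R g x) \<bullet> h)) (at x)"
    by (rule has_derivative_eq_rhs[OF has_derivative_compose[OF d(1)[OF x] d1[unfolded has_field_derivative_def]]])
       auto
  have 2: "((\<lambda>x. \<psi>' (f x)) has_derivative (\<lambda>h. \<psi>'' (f x) * (g x \<bullet> h))) (at x)"
    by (rule has_derivative_compose[OF d(1)[OF x] d2[unfolded has_field_derivative_def]])
  show "((\<lambda>x. \<psi>' (f x) *\<^sub>R g x) has_derivative
     (\<lambda>h. \<psi>'' (f x) *\<^sub>R ((g x \<bullet> h) *\<^sub>R g x) + \<psi>' (f x) *\<^sub>R H x h)) (at x)"
    by (rule has_derivative_eq_rhs[OF has_derivative_scaleR[OF 2 d(2)[OF x]]]) auto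
next
  have c': "continuous_on UNIV \<psi>'"
    using d2 by (meson DERIV_isCont continuous_at_imp_continuous_on)
  fix h show "continuous_on S (\<lambda>x. \<psi>'' (f x) *\<^sub>R ((g x \<bullet> h) *\<^sub>R g x) + \<psi>' (f x) *\<^sub>R H x h)"
    using C2_onD[OF f]
    by (intro continuous_intros continuous_on_compose2[OF c] continuous_on_compose2[OF c']) auto
qed

lemma lin_trace_add: "lin_trace (\<lambda>h. X h + Y h) = lin_trace X + lin_trace Y"
  and lin_trace_diff: "lin_trace (\<lambda>h. X h - Y h) = lin_trace X - lin_trace Y"
  and lin_trace_scaleR: "lin_trace (\<lambda>h. r *\<^sub>R X h) = r * lin_trace X"
  by (simp_all add: lin_trace_def inner_simps sum.distrib sum_subtractf sum_distrib_left)

lemma lin_trace_rank_one: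
  assumes "linear l"
  shows "lin_trace (\<lambda>h. l h *\<^sub>R y) = l y"
proof -
  have "l y = l (\<Sum>b\<in>Basis. (y \<bullet> b) *\<^sub>R b)" by (simp add: euclidean_representation)
  also have "\<dots> = (\<Sum>b\<in>Basis. (y \<bullet> b) * l b)"
    using assms by (simp add: linear_sum linear_cmul)
  finally show ?thesis by (simp add: lin_trace_def mult.commute)
qed

lemma lin_trace_inner: "lin_trace (\<lambda>h. (k \<bullet> h) *\<^sub>R y) = k \<bullet> y"
  by (rule lin_trace_rank_one) (simp add: bounded_linear.linear bounded_linear_inner_right)

lemma lin_trace_scaled_inner:
  "lin_trace (\<lambda>h. (r * (k \<bullet> h)) *\<^sub>R y) = r * (k \<bullet> y)"
  "lin_trace (\<lambda>h. ((k \<bullet> h) * r) *\<^sub>R y) = r * (k \<bullet> y)"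
  using lin_trace_scaleR[of r "\<lambda>h. (k \<bullet> h) *\<^sub>R y"] by (simp_all add: lin_trace_inner mult.commute)

lemma lin_trace_inner_linear:
  assumes "linear W"
  shows "lin_trace (\<lambda>h. (k \<bullet> W h) *\<^sub>R y) = k \<bullet> W y"
  by (rule lin_trace_rank_one)
     (use linear_compose[OF assms, of "\<lambda>z. k \<bullet> z"] in \<open>simp add: bounded_linear.linear bounded_linear_inner_right o_def\<close>)

lemma continuous_on_lin_trace:
  assumes "\<And>h. continuous_on S (\<lambda>x. W x h)"
  shows "continuous_on S (\<lambda>x. lin_trace (W x))"
  unfolding lin_trace_def by (intro continuous_intros assms)

section \<open>A Carleman estimate with a quadratic weight\<close>

text \<open>
  Let \<open>\<phi>\<close> be a weight with gradient \<open>a\<close> and constant Hessian \<open>P\<close>. Conjugating the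
  Laplacian with \<open>exp (\<tau> \<phi>)\<close> gives \<open>L = S + A\<close> with the symmetric part
  \<open>S v = \<Delta>v + \<tau>\<^sup>2 |a|\<^sup>2 v\<close> and the antisymmetric part
  \<open>A v = - 2 \<tau> a \<bullet> \<nabla>v - \<tau> tr P v\<close>. Up to a divergence, \<open>2 S v A v\<close> is
  \<open>4 \<tau> P \<nabla>v \<bullet> \<nabla>v + 4 \<tau>\<^sup>3 (P a \<bullet> a) v\<^sup>2\<close>.

  The matrix \<open>P\<close> may have negative directions, bounded by \<open>c/2\<close>. They are paid for
  by \<open>(S v)\<^sup>2 \<ge> - 2 c \<tau> v S v - c\<^sup>2 \<tau>\<^sup>2 v\<^sup>2\<close>, which up to a divergence
  contributes \<open>2 c \<tau> |\<nabla>v|\<^sup>2 - 2 c \<tau>\<^sup>3 |a|\<^sup>2 v\<^sup>2\<close>. What is then needed is a large enough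
  curvature \<open>P a \<bullet> a\<close> of the weight along its own gradient, and only on the support of
  \<open>v\<close>. If \<open>m > 0\<close>, the term of order \<open>\<tau>\<^sup>3\<close> dominates for large \<open>\<tau>\<close>.
\<close>

lemma carleman_conjugated:
  fixes v :: "'a::euclidean_space \<Rightarrow> real"
  assumes da: "\<And>x. (a has_derivative P) (at x)"
    and Pc: "\<And>h. P h \<bullet> h \<ge> - (c/2) * (h \<bullet> h)"
    and am: "\<And>x. v x \<noteq> 0 \<Longrightarrow> 4 * (P (a x) \<bullet> a x) - 2 * c * (a x \<bullet> a x) \<ge> m"
    and v: "C2_on UNIV v d W"
    and K: "compact K" "\<And>x. x \<notin> K \<Longrightarrow> v x = 0"
    and \<tau>: "0 < \<tau>"
  shows "(m * \<tau>^3 - c\<^sup>2 * \<tau>\<^sup>2) * integral\<^sup>L lborel (\<lambda>x. (v x)\<^sup>2)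
     \<le> integral\<^sup>L lborel (\<lambda>x. (lin_trace (W x) + \<tau>\<^sup>2 * (a x \<bullet> a x) * v x
            - 2 * \<tau> * (a x \<bullet> d x) - \<tau> * lin_trace P * v x)\<^sup>2)"
proof -
  note dv = C2_onD[OF v]
  have lW: "linear (W x)" for x using has_derivative_linear[OF dv(2)] by auto
  have lP: "linear P" using has_derivative_linear[OF da] .
  have ca: "continuous_on UNIV a"
    using da by (meson continuous_at_imp_continuous_on has_derivative_continuous)
  have Wsym: "W x h \<bullet> k = W x k \<bullet> h" for x h k
    by (rule hessian_symmetric[OF v]) auto
  define T where "T = lin_trace P"
  \<comment> \<open>The field whose divergence collects all total derivatives in \<open>2 S v A v - 2 c \<tau> v S v\<close>,
    and below its derivative.\<close>
  define F where "F x = (-2*\<tau>) *\<^sub>R (2 *\<^sub>R ((a x \<bullet> d x) *\<^sub>R d x) - (d x \<bullet> d x) *\<^sub>R a x)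
     + (-2*\<tau>*T - 2*c*\<tau>) *\<^sub>R (v x *\<^sub>R d x) + (-2*\<tau>^3) *\<^sub>R (((a x \<bullet> a x) * (v x * v x)) *\<^sub>R a x)" for x
  define F' where "F' x h = (-2*\<tau>) *\<^sub>R (2 *\<^sub>R ((d x \<bullet> P h) *\<^sub>R d x + (a x \<bullet> W x h) *\<^sub>R d x + (a x \<bullet> d x) *\<^sub>R W x h)
        - (2 *\<^sub>R ((d x \<bullet> W x h) *\<^sub>R a x) + (d x \<bullet> d x) *\<^sub>R P h))
     + (-2*\<tau>*T - 2*c*\<tau>) *\<^sub>R ((d x \<bullet> h) *\<^sub>R d x + v x *\<^sub>R W x h)
     + (-2*\<tau>^3) *\<^sub>R ((2 * (v x * v x)) *\<^sub>R ((a x \<bullet> P h) *\<^sub>R a x)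
         + (2 * v x * (a x \<bullet> a x)) *\<^sub>R ((d x \<bullet> h) *\<^sub>R a x) + ((a x \<bullet> a x) * (v x * v x)) *\<^sub>R P h)" for x h
  have dF: "(F has_derivative F' x) (at x)" for x
    unfolding F_def[abs_def] F'_def[abs_def]
    by (rule has_derivative_eq_rhs, (rule derivative_intros dv(1,2) da UNIV_I)+)
       (auto simp: fun_eq_iff inner_commute algebra_simps)
  have cF: "continuous_on UNIV (\<lambda>x. F' x h)" for h
    unfolding F'_def by (intro continuous_intros dv ca)
  have dout: "d x = 0" "W x = (\<lambda>h. 0)" if "x \<notin> K" for x
  proof -
    have o: "open (- K)" using K by (auto simp: compact_imp_closed open_Compl)
    have d0: "d x = 0" if "x \<notin> K" for x
      using has_derivative_zero_outside[OF dv(1)[of x] o] that K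
      by (auto simp: fun_eq_iff)
    show "d x = 0" using d0 that .
    show "W x = (\<lambda>h. 0)"
      using has_derivative_zero_outside[OF dv(2)[of x] o] that d0 by auto
  qed
  have Fout: "F x = 0" if "x \<notin> K" for x using K(2)[OF that] dout[OF that] by (simp add: F_def)
  note div = integral_divergence_zero[OF dF cF K(1) Fout]
  define L where "L x = lin_trace (W x) + \<tau>\<^sup>2 * (a x \<bullet> a x) * v x
            - 2 * \<tau> * (a x \<bullet> d x) - \<tau> * T * v x" for x
  have tr: "lin_trace (F' x) = (-2*\<tau>) * (2 * (d x \<bullet> P (d x) + (a x \<bullet> d x) * lin_trace (W x)) - (d x \<bullet> d x) * T)
     + (-2*\<tau>*T - 2*c*\<tau>) * (d x \<bullet> d x + v x * lin_trace (W x))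
     + (-2*\<tau>^3) * (2 * (v x * v x) * (a x \<bullet> P (a x))
         + 2 * v x * (a x \<bullet> a x) * (a x \<bullet> d x) + (a x \<bullet> a x) * (v x * v x) * T)" for x
    unfolding F'_def[abs_def]
    \<comment> \<open>Symmetry of the Hessian cancels \<open>a \<bullet> W d\<close> against \<open>d \<bullet> W a\<close>.\<close>
    using Wsym[of x "a x" "d x"]
    by (simp del: scaleR_scaleR scaleR_left_diff_distrib scaleR_minus_left
          add: lin_trace_add lin_trace_diff lin_trace_scaleR lin_trace_inner lin_trace_inner_linear lW lP
          T_def[symmetric])
       (simp add: inner_commute algebra_simps)
  have point: "(m * \<tau>^3 - c\<^sup>2 * \<tau>\<^sup>2) * (v x)\<^sup>2 \<le> (L x)\<^sup>2 - lin_trace (F' x)" for x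
  proof -
    define w where "w = lin_trace (W x)"
    define aa where "aa = a x \<bullet> a x"
    define ad where "ad = a x \<bullet> d x"
    define dd where "dd = d x \<bullet> d x"
    define pd where "pd = d x \<bullet> P (d x)"
    define pa where "pa = a x \<bullet> P (a x)"
    \<comment> \<open>Completing squares: \<open>(S v + c \<tau> v)\<^sup>2 + (A v)\<^sup>2\<close> plus the terms described above.\<close>
    have id: "(L x)\<^sup>2 - lin_trace (F' x) =
       (w + \<tau>\<^sup>2 * aa * v x + c * \<tau> * v x)\<^sup>2 + (2 * \<tau> * ad + \<tau> * T * v x)\<^sup>2
       + 2 * \<tau> * (2 * pd + c * dd) + \<tau>^3 * (4 * pa - 2 * c * aa) * (v x)\<^sup>2 - c\<^sup>2 * \<tau>\<^sup>2 * (v x)\<^sup>2"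
      unfolding tr L_def w_def[symmetric] aa_def[symmetric] ad_def[symmetric] dd_def[symmetric]
        pd_def[symmetric] pa_def[symmetric]
      by (simp add: power2_eq_square power3_eq_cube algebra_simps)
    have 1: "0 \<le> 2 * \<tau> * (2 * pd + c * dd)"
      using Pc[of "d x"] \<tau> by (intro mult_nonneg_nonneg) (auto simp: pd_def dd_def inner_commute)
    have 2: "\<tau>^3 * (4 * pa - 2 * c * aa) * (v x)\<^sup>2 \<ge> \<tau>^3 * m * (v x)\<^sup>2"
    proof (cases "v x = 0")
      case False
      then show ?thesis using am[OF False] \<tau>
        by (intro mult_right_mono mult_left_mono) (auto simp: pa_def aa_def inner_commute)
    qed auto
    have 3: "(m * \<tau>^3 - c\<^sup>2 * \<tau>\<^sup>2) * (v x)\<^sup>2 = \<tau>^3 * m * (v x)\<^sup>2 - c\<^sup>2 * \<tau>\<^sup>2 * (v x)\<^sup>2"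
      by (simp add: algebra_simps)
    show ?thesis unfolding id 3
      using 1 2 zero_le_power2[of "w + \<tau>\<^sup>2 * aa * v x + c * \<tau> * v x"]
        zero_le_power2[of "2 * \<tau> * ad + \<tau> * T * v x"] by linarith
  qed
  have iv: "integrable lborel (\<lambda>x. (v x)\<^sup>2)"
    by (rule integrable_continuous_compact_support[OF _ K(1)]) (auto simp: K intro!: continuous_intros dv)
  have iL: "integrable lborel (\<lambda>x. (L x)\<^sup>2)"
    by (rule integrable_continuous_compact_support[OF _ K(1)])
       (auto simp: K L_def dout lin_trace_def intro!: continuous_intros dv ca)
  have "(m * \<tau>^3 - c\<^sup>2 * \<tau>\<^sup>2) * integral\<^sup>L lborel (\<lambda>x. (v x)\<^sup>2)
      = integral\<^sup>L lborel (\<lambda>x. (m * \<tau>^3 - c\<^sup>2 * \<tau>\<^sup>2) * (v x)\<^sup>2)" by simp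
  also have "\<dots> \<le> integral\<^sup>L lborel (\<lambda>x. (L x)\<^sup>2 - lin_trace (F' x))"
    by (rule integral_mono) (use iv iL div(1) point in auto)
  also have "\<dots> = integral\<^sup>L lborel (\<lambda>x. (L x)\<^sup>2)"
    using iL div by simp
  finally show ?thesis unfolding L_def T_def .
qed

text \<open>
  The previous estimate for \<open>v = exp (\<tau> \<phi>) u\<close>: the conjugated operator applied to
  \<open>v\<close> is \<open>exp (\<tau> \<phi>) \<Delta>u\<close>.
\<close>

lemma carleman_estimate:
  fixes u \<phi> :: "'a::euclidean_space \<Rightarrow> real"
  assumes \<phi>: "C2_on UNIV \<phi> a (\<lambda>x. P)"
    and Pc: "\<And>h. P h \<bullet> h \<ge> - (c/2) * (h \<bullet> h)"
    and am: "\<And>x. u x \<noteq> 0 \<Longrightarrow> 4 * (P (a x) \<bullet> a x) - 2 * c * (a x \<bullet> a x) \<ge> m"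
    and u: "C2_on UNIV u g H"
    and K: "compact K" "\<And>x. x \<notin> K \<Longrightarrow> u x = 0"
    and \<tau>: "0 < \<tau>"
  shows "(m * \<tau>^3 - c\<^sup>2 * \<tau>\<^sup>2) * integral\<^sup>L lborel (\<lambda>x. (exp (\<tau> * \<phi> x) * u x)\<^sup>2)
     \<le> integral\<^sup>L lborel (\<lambda>x. (exp (\<tau> * \<phi> x) * lin_trace (H x))\<^sup>2)"
proof -
  have e: "C2_on UNIV (\<lambda>x. exp (\<tau> * \<phi> x)) (\<lambda>x. (\<tau> * exp (\<tau> * \<phi> x)) *\<^sub>R a x)
    (\<lambda>x h. (\<tau> * (\<tau> * exp (\<tau> * \<phi> x))) *\<^sub>R ((a x \<bullet> h) *\<^sub>R a x) + (\<tau> * exp (\<tau> * \<phi> x)) *\<^sub>R P h)"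
    by (rule C2_on_compose[OF \<phi>]) (auto intro!: derivative_eq_intros continuous_intros)
  note v = C2_on_mult[OF e u]
  have da: "(a has_derivative P) (at x)" for x using C2_onD(2)[OF \<phi>] by auto
  have eq: "lin_trace (\<lambda>h. ((\<tau> * exp (\<tau> * \<phi> x)) *\<^sub>R a x \<bullet> h) *\<^sub>R g x + exp (\<tau> * \<phi> x) *\<^sub>R H x h +
               (g x \<bullet> h) *\<^sub>R (\<tau> * exp (\<tau> * \<phi> x)) *\<^sub>R a x +
               u x *\<^sub>R ((\<tau> * (\<tau> * exp (\<tau> * \<phi> x))) *\<^sub>R (a x \<bullet> h) *\<^sub>R a x + (\<tau> * exp (\<tau> * \<phi> x)) *\<^sub>R P h)) +
            \<tau>\<^sup>2 * (a x \<bullet> a x) * (exp (\<tau> * \<phi> x) * u x) -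
            2 * \<tau> * (a x \<bullet> (exp (\<tau> * \<phi> x) *\<^sub>R g x + u x *\<^sub>R (\<tau> * exp (\<tau> * \<phi> x)) *\<^sub>R a x)) -
            \<tau> * lin_trace P * (exp (\<tau> * \<phi> x) * u x) = exp (\<tau> * \<phi> x) * lin_trace (H x)" for x
    by (simp add: lin_trace_add lin_trace_scaleR lin_trace_inner lin_trace_scaled_inner inner_simps)
       (simp add: inner_commute algebra_simps power2_eq_square)
  have "(m * \<tau>^3 - c\<^sup>2 * \<tau>\<^sup>2) * integral\<^sup>L lborel (\<lambda>x. (exp (\<tau> * \<phi> x) * u x)\<^sup>2)
     \<le> integral\<^sup>L lborel (\<lambda>x. (lin_trace (\<lambda>h. ((\<tau> * exp (\<tau> * \<phi> x)) *\<^sub>R a x \<bullet> h) *\<^sub>R g x + exp (\<tau> * \<phi> x) *\<^sub>R H x h +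
               (g x \<bullet> h) *\<^sub>R (\<tau> * exp (\<tau> * \<phi> x)) *\<^sub>R a x +
               u x *\<^sub>R ((\<tau> * (\<tau> * exp (\<tau> * \<phi> x))) *\<^sub>R (a x \<bullet> h) *\<^sub>R a x + (\<tau> * exp (\<tau> * \<phi> x)) *\<^sub>R P h)) +
            \<tau>\<^sup>2 * (a x \<bullet> a x) * (exp (\<tau> * \<phi> x) * u x) -
            2 * \<tau> * (a x \<bullet> (exp (\<tau> * \<phi> x) *\<^sub>R g x + u x *\<^sub>R (\<tau> * exp (\<tau> * \<phi> x)) *\<^sub>R a x)) -
            \<tau> * lin_trace P * (exp (\<tau> * \<phi> x) * u x))\<^sup>2)"
    by (rule carleman_conjugated[OF da Pc _ v K(1) _ \<tau>]) (auto simp: K am)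
  then show ?thesis unfolding eq .
qed

section \<open>Unique continuation\<close>

text \<open>
  A function that vanishes on the open set \<open>U - K\<close> has vanishing derivatives there, so the
  extension by zero across the boundary of \<open>U\<close> is as smooth as the function inside.
\<close>

lemma C2_on_extend_zero:
  fixes f :: "'a::euclidean_space \<Rightarrow> real"
  assumes f: "C2_on U f g H" and U: "open U" and K: "closed K" "K \<subseteq> U"
    and 0: "\<And>x. x \<in> U \<Longrightarrow> x \<notin> K \<Longrightarrow> f x = 0"
  shows "C2_on UNIV (\<lambda>x. if x \<in> U then f x else 0) (\<lambda>x. if x \<in> U then g x else 0)
           (\<lambda>x h. if x \<in> U then H x h else 0)"
proof -
  have o: "open (- K)" "open (U - K)" using K U by auto
  have g0: "g x = 0" if "x \<in> U" "x \<notin> K" for x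
    using has_derivative_zero_outside[OF C2_onD(1)[OF f that(1)] o(2)] that 0
    by (auto simp: fun_eq_iff)
  have H0: "H x = (\<lambda>h. 0)" if "x \<in> U" "x \<notin> K" for x
    using has_derivative_zero_outside[OF C2_onD(2)[OF f that(1)] o(2)] that g0 by auto
  have "((\<lambda>x. if x \<in> U then f x else 0) has_derivative (\<lambda>h. (if x \<in> U then g x else 0) \<bullet> h)) (at x)
    \<and> ((\<lambda>x. if x \<in> U then g x else 0) has_derivative (\<lambda>h. if x \<in> U then H x h else 0)) (at x)" for x
  proof (cases "x \<in> U")
    case True
    show ?thesis
    proof
      show "((\<lambda>x. if x \<in> U then f x else 0) has_derivative (\<lambda>h. (if x \<in> U then g x else 0) \<bullet> h)) (at x)"
        by (rule has_derivative_transform_within_open[of f _ _ _ U]) (use C2_onD(1)[OF f True] U True in auto)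
      show "((\<lambda>x. if x \<in> U then g x else 0) has_derivative (\<lambda>h. if x \<in> U then H x h else 0)) (at x)"
        by (rule has_derivative_transform_within_open[of g _ _ _ U]) (use C2_onD(2)[OF f True] U True in auto)
    qed
  next
    case False
    then have xK: "x \<in> - K" using K by auto
    show ?thesis
    proof
      show "((\<lambda>x. if x \<in> U then f x else 0) has_derivative (\<lambda>h. (if x \<in> U then g x else 0) \<bullet> h)) (at x)"
        by (rule has_derivative_transform_within_open[of "\<lambda>_. 0" _ _ _ "- K"]) (use False xK o 0 in auto)
      show "((\<lambda>x. if x \<in> U then g x else 0) has_derivative (\<lambda>h. if x \<in> U then H x h else 0)) (at x)"
        by (rule has_derivative_transform_within_open[of "\<lambda>_. 0" _ _ _ "- K"]) (use False xK o g0 in auto)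
    qed
  qed
  moreover have "continuous_on UNIV (\<lambda>x. if x \<in> U then H x h else 0)" for h
  proof -
    have "continuous_on (U \<union> - K) (\<lambda>x. if x \<in> U then H x h else 0)"
      by (rule continuous_on_open_Un[OF U o(1)])
         (use C2_onD(3)[OF f, of h] H0 in \<open>auto cong: continuous_on_cong simp: continuous_on_const
            intro: continuous_on_eq[of _ "\<lambda>_. 0"]\<close>)
    moreover have "U \<union> - K = UNIV" using K by auto
    ultimately show ?thesis by simp
  qed
  ultimately show ?thesis by (auto simp: C2_on_def)
qed

text \<open>
  With \<open>m s = (max 0 s)^3\<close>, which is twice continuously differentiable, the function
  \<open>1 - m (1 - m s)\<close> is such a step from 0 to 1.
\<close>

lemma C2_step_function_exists:
  "\<exists>\<eta> \<eta>' \<eta>'' :: real \<Rightarrow> real. (\<forall>s. (\<eta> has_real_derivative \<eta>' s) (at s)) \<and>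
     (\<forall>s. (\<eta>' has_real_derivative \<eta>'' s) (at s)) \<and> continuous_on UNIV \<eta>'' \<and>
     (\<forall>s\<le>0. \<eta> s = 0) \<and> (\<forall>s\<ge>1. \<eta> s = 1 \<and> \<eta>' s = 0 \<and> \<eta>'' s = 0)"
proof -
  define m :: "real \<Rightarrow> real" where "m s = (max 0 s)^3" for s
  define m' :: "real \<Rightarrow> real" where "m' s = 3 * (max 0 s)^2" for s
  define m'' :: "real \<Rightarrow> real" where "m'' s = 6 * max 0 s" for s
  have pow: "((\<lambda>s. (max 0 s)^(Suc (Suc k))) has_real_derivative real (Suc (Suc k)) * (max 0 s)^(Suc k)) (at s)"
    for s :: real and k
  proof (rule DERIV_cong[where X = "real (Suc (Suc k)) * (max 0 s)^(Suc k)"], cases "s = 0")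
    case True
    have "((\<lambda>h. (max 0 h)^(Suc (Suc k)) / h) \<longlongrightarrow> 0) (at (0::real))"
    proof (rule Lim_null_comparison)
      have "norm ((max 0 h)^(Suc (Suc k)) / h) \<le> \<bar>h\<bar>^(Suc k)" for h :: real
        by (cases "0 < h") (auto simp: max_absorb1 max_absorb2 not_less mult_nonpos_nonneg)
      then show "\<forall>\<^sub>F h in at 0. norm ((max 0 h)^(Suc (Suc k)) / h) \<le> \<bar>h\<bar>^(Suc k)" by simp
      have "((\<lambda>h::real. \<bar>h\<bar>^(Suc k)) \<longlongrightarrow> \<bar>0\<bar>^(Suc k)) (at 0)" by (intro tendsto_intros)
      then show "((\<lambda>h::real. \<bar>h\<bar>^(Suc k)) \<longlongrightarrow> 0) (at 0)" by simp
    qed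
    then show "((\<lambda>s. (max 0 s)^(Suc (Suc k))) has_real_derivative real (Suc (Suc k)) * (max 0 s)^(Suc k)) (at s)"
      using True by (simp add: DERIV_def)
  next
    case False
    show "((\<lambda>s. (max 0 s)^(Suc (Suc k))) has_real_derivative real (Suc (Suc k)) * (max 0 s)^(Suc k)) (at s)"
    proof (cases "s > 0")
      case True
      have "((\<lambda>s. s^(Suc (Suc k))) has_real_derivative real (Suc (Suc k)) * s^(Suc k)) (at s)"
        using DERIV_pow[of "Suc (Suc k)" s] by simp
      then have "((\<lambda>s. (max 0 s)^(Suc (Suc k))) has_real_derivative real (Suc (Suc k)) * s^(Suc k)) (at s)"
        by (rule has_field_derivative_transform_within_open[of _ _ _ "{0<..}"]) (use True in auto)
      then show ?thesis using True by (simp add: max_absorb2)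
    next
      case F: False
      have "((\<lambda>s. (max 0 s)^(Suc (Suc k))) has_real_derivative 0) (at s)"
        by (rule has_field_derivative_transform_within_open[of "\<lambda>_. 0" _ _ "{..<0}"])
           (use F False in \<open>auto simp: max_absorb1\<close>)
      then show ?thesis using F by (simp add: max_absorb1)
    qed
  qed auto
  have d1: "(m has_real_derivative m' s) (at s)" for s
    unfolding m_def[abs_def] m'_def using pow[of 1 s] by (simp add: numeral_eq_Suc)
  have d2: "(m' has_real_derivative m'' s) (at s)" for s
    unfolding m'_def[abs_def] m''_def using DERIV_cmult[OF pow[of 0 s], of 3] by (simp add: numeral_eq_Suc)
  have c2: "continuous_on UNIV m''" unfolding m''_def by (intro continuous_intros)
  have c1: "continuous_on UNIV m'" unfolding m'_def by (intro continuous_intros)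
  have c0: "continuous_on UNIV m" unfolding m_def by (intro continuous_intros)
  define \<eta> where "\<eta> s = 1 - m (1 - m s)" for s
  define \<eta>' where "\<eta>' s = m' (1 - m s) * m' s" for s
  define \<eta>'' where "\<eta>'' s = m' (1 - m s) * m'' s - m'' (1 - m s) * m' s * m' s" for s
  have "(\<eta> has_real_derivative \<eta>' s) (at s)" for s
    unfolding \<eta>_def[abs_def] \<eta>'_def
    by (auto intro!: derivative_eq_intros DERIV_chain2[OF d1] d1)
  moreover have "(\<eta>' has_real_derivative \<eta>'' s) (at s)" for s
    unfolding \<eta>'_def[abs_def] \<eta>''_def
    by (auto intro!: derivative_eq_intros DERIV_chain2[OF d2] d1 d2)
  moreover have "continuous_on UNIV \<eta>''"
    unfolding \<eta>''_def by (intro continuous_intros continuous_on_compose2[OF c2] continuous_on_compose2[OF c1] c0 c1 c2) auto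
  moreover have "\<eta> s = 0" if "s \<le> 0" for s using that by (simp add: \<eta>_def m_def)
  moreover have "\<eta> s = 1 \<and> \<eta>' s = 0 \<and> \<eta>'' s = 0" if "s \<ge> 1" for s
  proof -
    have "m s \<ge> 1" using that by (simp add: m_def)
    then have "m (1 - m s) = 0" "m' (1 - m s) = 0" "m'' (1 - m s) = 0"
      by (auto simp: m_def m'_def m''_def)
    then show ?thesis by (simp add: \<eta>_def \<eta>'_def \<eta>''_def)
  qed
  ultimately show ?thesis by blast
qed

text \<open>
  A weight for continuing across a sphere with centre \<open>y\<close> and radius \<open>r\<close> at its point
  \<open>p\<close>, from the inside to the outside. With the outer unit normal \<open>\<nu>\<close> and
  \<open>z = x - p\<close> it is \<open>- \<nu> \<bullet> z - |z|\<^sup>2/r + 4 (\<nu> \<bullet> z)\<^sup>2/r\<close>. The second term bends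
  the level sets more strongly than the sphere: among the points near \<open>p\<close> outside the ball, the
  weight has a strict maximum at \<open>p\<close>. This costs negative curvature in the tangential directions,
  and the third term buys convexity along the gradient, whose direction near \<open>p\<close> is close to \<open>\<nu>\<close>. The factor 4
  and the radius \<open>r/16\<close> are large, respectively small, enough for both effects.
\<close>

lemma touching_ball_weight:
  fixes p y :: "'a::euclidean_space"
  assumes r: "0 < r" "dist p y = r"
  obtains \<phi> a P where
    "C2_on UNIV \<phi> a (\<lambda>x. P)" "\<phi> p = 0"
    "\<And>h. P h \<bullet> h \<ge> - ((4/r)/2) * (h \<bullet> h)"
    "\<And>x. dist x p \<le> r/16 \<Longrightarrow> 4 * (P (a x) \<bullet> a x) - 2 * (4/r) * (a x \<bullet> a x) \<ge> 1/r"
    "\<And>x. dist x p \<le> r/16 \<Longrightarrow> r \<le> dist x y \<Longrightarrow> \<phi> x \<le> - (dist x p)\<^sup>2 / (4 * r)"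
proof -
  define \<nu> where "\<nu> = (1/r) *\<^sub>R (p - y)"
  have \<nu>: "\<nu> \<bullet> \<nu> = 1" "norm \<nu> = 1" "p - y = r *\<^sub>R \<nu>"
  proof -
    show n: "norm \<nu> = 1" using r by (simp add: \<nu>_def dist_norm)
    then show "\<nu> \<bullet> \<nu> = 1" by (simp add: norm_eq_1)
    show "p - y = r *\<^sub>R \<nu>" using r by (simp add: \<nu>_def)
  qed
  define \<phi> where "\<phi> x = - (\<nu> \<bullet> (x - p)) - (1/r) * ((x - p) \<bullet> (x - p)) + (4/r) * (\<nu> \<bullet> (x - p))\<^sup>2" for x
  define a where "a x = - \<nu> - (2/r) *\<^sub>R (x - p) + (8/r * (\<nu> \<bullet> (x - p))) *\<^sub>R \<nu>" for x
  define P where "P h = - (2/r) *\<^sub>R h + (8/r * (\<nu> \<bullet> h)) *\<^sub>R \<nu>" for h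
  have C2: "C2_on UNIV \<phi> a (\<lambda>x. P)"
    unfolding C2_on_def
  proof (intro conjI ballI allI)
    define \<kappa> where "\<kappa> = 1/r"
    have \<phi>_alt: "\<phi> = (\<lambda>x. - (\<nu> \<bullet> (x - p)) - \<kappa> * ((x - p) \<bullet> (x - p)) + (4*\<kappa>) * ((\<nu> \<bullet> (x - p)) * (\<nu> \<bullet> (x - p))))"
      and a_alt: "a = (\<lambda>x. - \<nu> - (2*\<kappa>) *\<^sub>R (x - p) + ((8*\<kappa>) * (\<nu> \<bullet> (x - p))) *\<^sub>R \<nu>)"
      and P_alt: "P = (\<lambda>h. - (2*\<kappa>) *\<^sub>R h + ((8*\<kappa>) * (\<nu> \<bullet> h)) *\<^sub>R \<nu>)"
      by (auto simp: \<phi>_def a_def P_def \<kappa>_def power2_eq_square)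
    show "(\<phi> has_derivative (\<lambda>h. a x \<bullet> h)) (at x)" for x
      unfolding \<phi>_alt a_alt
      by (rule has_derivative_eq_rhs, (rule derivative_intros)+)
         (auto simp: fun_eq_iff inner_simps inner_commute algebra_simps)
    show "(a has_derivative P) (at x)" for x
      unfolding a_alt P_alt
      by (rule has_derivative_eq_rhs, (rule derivative_intros)+)
         (auto simp: fun_eq_iff algebra_simps)
  qed (auto)
  have PP: "P h \<bullet> h = - (2/r) * (h \<bullet> h) + (8/r) * (\<nu> \<bullet> h)\<^sup>2" for h
    by (simp add: P_def inner_simps power2_eq_square)
  have tube: "\<bar>\<nu> \<bullet> (x - p)\<bar> \<le> dist x p" for x
    using Cauchy_Schwarz_ineq2[of \<nu> "x - p"] by (simp add: \<nu> dist_norm)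
  have am: "4 * (P (a x) \<bullet> a x) - 2 * (4/r) * (a x \<bullet> a x) \<ge> 1/r" if x: "dist x p \<le> r/16" for x
  proof -
    define z where "z = x - p"
    define s where "s = \<nu> \<bullet> z"
    have s: "\<bar>s\<bar> \<le> r/16" using tube[of x] x by (simp add: s_def z_def)
    have zz: "z \<bullet> z \<le> r\<^sup>2/256"
    proof -
      have "(dist x p)\<^sup>2 \<le> (r/16)\<^sup>2" using x by (intro power_mono) auto
      then show ?thesis by (simp add: z_def dist_norm power2_norm_eq_inner power_divide)
    qed
    \<comment> \<open>Near \<open>p\<close> the gradient is dominated by its normal part: at least 5/8 in size, while the
      tangential part contributes at most 1/64 to the square of the norm.\<close>
    have na: "\<nu> \<bullet> a x = -1 + 6/r * s"
    proof -
      have "\<nu> \<bullet> a x = - (\<nu> \<bullet> \<nu>) - 2/r * s + 8/r * s * (\<nu> \<bullet> \<nu>)"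
        unfolding a_def z_def[symmetric] s_def by (simp only: inner_add_right inner_diff_right inner_minus_right inner_scaleR_right)
      then show ?thesis unfolding \<nu>(1) by (simp add: field_simps)
    qed
    have "\<bar>6/r * s\<bar> \<le> 6/16" using s r by (simp add: abs_mult field_simps)
    then have "\<nu> \<bullet> a x \<le> - (5/8)" unfolding na by linarith
    then have "(5/8)\<^sup>2 \<le> (- (\<nu> \<bullet> a x))\<^sup>2" by (intro power_mono) auto
    then have na2: "25/64 \<le> (\<nu> \<bullet> a x)\<^sup>2" by (simp add: power_divide)
    have aa: "a x \<bullet> a x = (\<nu> \<bullet> a x)\<^sup>2 + 4/r\<^sup>2 * (z \<bullet> z - s\<^sup>2)"
      unfolding na
      by (simp add: a_def z_def[symmetric] inner_simps \<nu> s_def[symmetric] inner_commute[of z \<nu>])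
         (use r in \<open>simp add: field_simps power2_eq_square\<close>)
    have "4/r\<^sup>2 * (z \<bullet> z - s\<^sup>2) \<le> 4/r\<^sup>2 * (r\<^sup>2/256)"
    proof (rule mult_left_mono)
      show "z \<bullet> z - s\<^sup>2 \<le> r\<^sup>2/256" using zz zero_le_power2[of s] by linarith
    qed simp
    also have "\<dots> = 1/64" using r by simp
    finally have "a x \<bullet> a x \<le> (\<nu> \<bullet> a x)\<^sup>2 + 1/64" unfolding aa by simp
    then have "1 \<le> 32 * (\<nu> \<bullet> a x)\<^sup>2 - 16 * (a x \<bullet> a x)" using na2 by linarith
    then have "1/r * 1 \<le> 1/r * (32 * (\<nu> \<bullet> a x)\<^sup>2 - 16 * (a x \<bullet> a x))"
      using r by (intro mult_left_mono) auto
    moreover have "4 * (P (a x) \<bullet> a x) - 2 * (4/r) * (a x \<bullet> a x) = 1/r * (32 * (\<nu> \<bullet> a x)\<^sup>2 - 16 * (a x \<bullet> a x))"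
      unfolding PP using r by (simp add: field_simps)
    ultimately show ?thesis by simp
  qed
  have decay: "\<phi> x \<le> - (dist x p)\<^sup>2 / (4 * r)" if x: "dist x p \<le> r/16" "r \<le> dist x y" for x
  proof -
    define s where "s = \<nu> \<bullet> (x - p)"
    define q where "q = (dist x p)\<^sup>2"
    have s: "\<bar>s\<bar> \<le> r/16" using tube[of x] x by (simp add: s_def)
    have q: "q = (x - p) \<bullet> (x - p)" by (simp add: q_def dist_norm power2_norm_eq_inner)
    \<comment> \<open>Being outside the ball says \<open>- \<nu> \<bullet> z \<le> |z|\<^sup>2 / (2 r)\<close>.\<close>
    have "r\<^sup>2 \<le> (dist x y)\<^sup>2" using x r by (intro power_mono) auto
    also have "x - y = (x - p) + r *\<^sub>R \<nu>" using \<nu>(3) by (simp add: algebra_simps)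
    then have "(dist x y)\<^sup>2 = q + 2 * r * s + r\<^sup>2"
      unfolding dist_norm power2_norm_eq_inner q s_def
      by (simp add: inner_simps \<nu> inner_commute power2_eq_square algebra_simps)
    finally have qs: "0 \<le> q + 2 * r * s" by simp
    have phi: "\<phi> x = - s - q / r + 4 * s\<^sup>2 / r" by (simp add: \<phi>_def q s_def)
    have "r * \<phi> x = - r * s - q + 4 * s\<^sup>2" unfolding phi using r by (simp add: field_simps)
    also have "\<dots> \<le> - q / 4"
    proof (cases "0 \<le> s")
      case True
      then have "s * s \<le> r/16 * s" using s by (intro mult_right_mono) auto
      moreover have "0 \<le> r * s" "0 \<le> q" using True r by (auto simp: q_def)
      ultimately show ?thesis by (simp add: power2_eq_square)
    next
      case False
      then have "(-s) * (-s) \<le> r/16 * (-s)" using s by (intro mult_right_mono) auto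
      moreover have "0 \<le> q" by (simp add: q_def)
      ultimately show ?thesis using qs by (simp add: power2_eq_square)
    qed
    finally show ?thesis using r by (simp add: q_def field_simps)
  qed
  show thesis
  proof (rule that[OF C2 _ _ am decay])
    show "\<phi> p = 0" by (simp add: \<phi>_def)
    show "P h \<bullet> h \<ge> - ((4/r)/2) * (h \<bullet> h)" for h using r by (simp add: PP)
  qed
qed

text \<open>
  The Carleman estimate is applied to \<open>u = \<eta> (b \<phi> + 2) w\<close>, where the cutoff is a step
  function of the weight itself. Since \<open>w\<close> lives outside the ball, where \<open>\<phi>\<close> has a strict maximum
  0 at \<open>p\<close>, this makes the support of \<open>u\<close> compact near \<open>p\<close>. Where the cutoff
  differs from 1 the weight is at most \<open>- \<delta>/2\<close>, so the error is of order \<open>exp (- \<tau> \<delta>)\<close>; the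
  potential term is absorbed for large \<open>\<tau>\<close>. If \<open>w\<close> were nonzero at a point close
  to \<open>p\<close>, where \<open>\<phi> > - \<delta>/4\<close>, the weighted integral of \<open>u\<^sup>2\<close> would be at least of order \<open>exp (- \<tau> \<delta>/2)\<close>, which is
  impossible as \<open>\<tau>\<close> grows.
\<close>

lemma unique_continuation_touching_ball:
  fixes w :: "'a::euclidean_space \<Rightarrow> real"
  assumes S: "open S" and w: "C2_on S w g H" and V: "continuous_on S V"
    and eq: "\<And>x. x \<in> S \<Longrightarrow> lin_trace (H x) = V x * w x"
    and p: "p \<in> S" and r: "0 < r" "dist p y = r"
    and w0: "\<And>x. x \<in> S \<Longrightarrow> dist x y < r \<Longrightarrow> w x = 0"
  shows "\<exists>e>0. ball p e \<subseteq> S \<and> (\<forall>x\<in>ball p e. w x = 0)"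
proof -
  obtain \<phi> a P where \<phi>: "C2_on UNIV \<phi> a (\<lambda>x. P)" "\<phi> p = 0"
    and P: "\<And>h. P h \<bullet> h \<ge> - ((4/r)/2) * (h \<bullet> h)"
    and am: "\<And>x. dist x p \<le> r/16 \<Longrightarrow> 4 * (P (a x) \<bullet> a x) - 2 * (4/r) * (a x \<bullet> a x) \<ge> 1/r"
    and decay: "\<And>x. dist x p \<le> r/16 \<Longrightarrow> r \<le> dist x y \<Longrightarrow> \<phi> x \<le> - (dist x p)\<^sup>2 / (4 * r)"
    using touching_ball_weight[OF r] by metis
  obtain \<rho>0 where \<rho>0: "0 < \<rho>0" "ball p \<rho>0 \<subseteq> S" using S p by (meson openE)
  define \<rho> where "\<rho> = min \<rho>0 (r/16)"
  have \<rho>: "0 < \<rho>" "\<rho> \<le> r/16" using \<rho>0 r by (auto simp: \<rho>_def)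
  define U where "U = ball p \<rho>"
  define K where "K = cball p (\<rho>/2)"
  have U: "open U" "U \<subseteq> S" using \<rho>0 by (auto simp: U_def \<rho>_def)
  have K: "compact K" "closed K" "K \<subseteq> U" using \<rho> by (auto simp: K_def U_def)
  \<comment> \<open>Outside the ball \<open>\<phi> \<le> - \<delta>\<close> for every point of \<open>U - K\<close>: this is
    \<open>(\<rho>/2)\<^sup>2 / (4 r)\<close>.\<close>
  define \<delta> where "\<delta> = \<rho>\<^sup>2 / (16 * r)"
  have \<delta>: "0 < \<delta>" using \<rho> r by (simp add: \<delta>_def)
  obtain \<eta> \<eta>' \<eta>'' where \<eta>: "\<And>s::real. (\<eta> has_real_derivative \<eta>' s) (at s)"
     "\<And>s. (\<eta>' has_real_derivative \<eta>'' s) (at s)" "continuous_on UNIV \<eta>''"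
     "\<And>s. s \<le> 0 \<Longrightarrow> \<eta> s = 0" "\<And>s. s \<ge> 1 \<Longrightarrow> \<eta> s = 1 \<and> \<eta>' s = 0 \<and> \<eta>'' s = 0"
    using C2_step_function_exists by metis
  \<comment> \<open>The argument \<open>b \<phi> + 2\<close> of the step runs from 0 to 1 as \<open>\<phi>\<close> runs from
    \<open>- \<delta>\<close> to \<open>- \<delta>/2\<close>.\<close>
  define b where "b = 2 / \<delta>"
  have cut: "C2_on UNIV (\<lambda>x. \<eta> (b * \<phi> x + 2)) (\<lambda>x. (b * \<eta>' (b * \<phi> x + 2)) *\<^sub>R a x)
    (\<lambda>x h. (b * (b * \<eta>'' (b * \<phi> x + 2))) *\<^sub>R ((a x \<bullet> h) *\<^sub>R a x) + (b * \<eta>' (b * \<phi> x + 2)) *\<^sub>R P h)"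
  proof (rule C2_on_compose[OF \<phi>(1)])
    have lin: "((\<lambda>s. b * s + 2) has_real_derivative b) (at s)" for s
      by (auto intro!: derivative_eq_intros)
    show "((\<lambda>s. \<eta> (b * s + 2)) has_real_derivative b * \<eta>' (b * s + 2)) (at s)" for s
      using DERIV_chain2[OF \<eta>(1) lin, of s] by (simp add: mult.commute)
    show "((\<lambda>s. b * \<eta>' (b * s + 2)) has_real_derivative b * (b * \<eta>'' (b * s + 2))) (at s)" for s
      using DERIV_cmult[OF DERIV_chain2[OF \<eta>(2) lin, of s], of b] by (simp add: mult.commute)
    show "continuous_on UNIV (\<lambda>s. b * (b * \<eta>'' (b * s + 2)))"
      by (intro continuous_intros continuous_on_compose2[OF \<eta>(3)]) auto
  qed
  define u where "u x = (if x \<in> U then \<eta> (b * \<phi> x + 2) * w x else 0)" for x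
  obtain gu Hu where u: "C2_on UNIV u gu Hu"
    and Hu: "\<And>x. x \<in> U \<Longrightarrow> - \<delta>/2 \<le> \<phi> x \<Longrightarrow> Hu x = H x"
    and Hu0: "\<And>x. x \<notin> K \<Longrightarrow> Hu x = (\<lambda>h. 0)" and u0: "\<And>x. x \<notin> K \<Longrightarrow> u x = 0"
  proof -
    have out: "\<eta> (b * \<phi> x + 2) * w x = 0" if x: "x \<in> U" "x \<notin> K" for x
    proof (cases "dist x y < r")
      case True then show ?thesis using w0 x U by auto
    next
      case False
      have d: "dist x p \<le> r/16" "\<rho>/2 \<le> dist x p"
        using x \<rho> by (auto simp: U_def K_def dist_commute)
      have "(\<rho>/2)\<^sup>2 \<le> (dist x p)\<^sup>2" using d \<rho> by (intro power_mono) auto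
      then have "\<phi> x \<le> - \<delta>" using decay[OF d(1)] False r
        by (simp add: \<delta>_def field_simps power2_eq_square)
      then have "b * \<phi> x + 2 \<le> 0" using \<delta> by (simp add: b_def field_simps)
      then show ?thesis using \<eta>(4) by simp
    qed
    note m = C2_on_mult[OF C2_on_subset[OF cut subset_UNIV] C2_on_subset[OF w U(2)]]
    note ext = C2_on_extend_zero[OF m U(1) K(2,3) out]
    let ?H = "\<lambda>x h. if x \<in> U then ((b * \<eta>' (b * \<phi> x + 2)) *\<^sub>R a x \<bullet> h) *\<^sub>R g x +
           \<eta> (b * \<phi> x + 2) *\<^sub>R H x h +
           (g x \<bullet> h) *\<^sub>R (b * \<eta>' (b * \<phi> x + 2)) *\<^sub>R a x +
           w x *\<^sub>R ((b * (b * \<eta>'' (b * \<phi> x + 2))) *\<^sub>R (a x \<bullet> h) *\<^sub>R a x + (b * \<eta>' (b * \<phi> x + 2)) *\<^sub>R P h) else 0"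
    have u: "C2_on UNIV u
       (\<lambda>x. if x \<in> U then \<eta> (b * \<phi> x + 2) *\<^sub>R g x + w x *\<^sub>R (b * \<eta>' (b * \<phi> x + 2)) *\<^sub>R a x else 0) ?H"
      using ext unfolding u_def[abs_def] .
    have z: "u x = 0" if "x \<notin> K" for x using out[of x] that by (auto simp: u_def)
    have o: "open (- K)" using K by auto
    have gz: "(if x \<in> U then \<eta> (b * \<phi> x + 2) *\<^sub>R g x + w x *\<^sub>R (b * \<eta>' (b * \<phi> x + 2)) *\<^sub>R a x else 0) = 0"
      if "x \<notin> K" for x
      using has_derivative_zero_outside[OF C2_onD(1)[OF u, of x] o] that z
      by (auto simp: fun_eq_iff)
    show thesis
    proof (rule that[OF u])
      fix x assume "x \<notin> K"
      then show "?H x = (\<lambda>h. 0)"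
        using has_derivative_zero_outside[OF C2_onD(2)[OF u, of x] o] gz by simp
      show "u x = 0" using z \<open>x \<notin> K\<close> .
    next
      fix x assume x: "x \<in> U" "- \<delta>/2 \<le> \<phi> x"
      then have "b * \<phi> x + 2 \<ge> 1" using \<delta> by (simp add: b_def field_simps)
      then show "?H x = H x" using x \<eta>(5)[of "b * \<phi> x + 2"] by simp
    qed
  qed
  have uw: "u x = w x" if "x \<in> U" "- \<delta>/2 \<le> \<phi> x" for x
  proof -
    have "b * \<phi> x + 2 \<ge> 1" using that \<delta> by (simp add: b_def field_simps)
    then show ?thesis using \<eta>(5)[of "b * \<phi> x + 2"] that by (simp add: u_def)
  qed
  note cu = C2_onD[OF u]
  define D where "D x = lin_trace (Hu x)" for x
  have cD: "continuous_on UNIV D" unfolding D_def by (rule continuous_on_lin_trace) (rule cu)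
  have c\<phi>: "continuous_on UNIV \<phi>" by (rule C2_onD[OF \<phi>(1)])
  have "bounded (V ` K)" "bounded (D ` K)"
    using K U by (auto intro!: compact_imp_bounded compact_continuous_image
        intro: continuous_on_subset[OF V] continuous_on_subset[OF cD])
  then obtain C1 C2 where C1: "\<And>x. x \<in> K \<Longrightarrow> \<bar>V x\<bar> \<le> C1" and C2: "\<And>x. x \<in> K \<Longrightarrow> \<bar>D x\<bar> \<le> C2"
    unfolding bounded_iff by auto
  define I where "I \<tau> = integral\<^sup>L lborel (\<lambda>x. (exp (\<tau> * \<phi> x) * u x)\<^sup>2)" for \<tau>
  have iI: "integrable lborel (\<lambda>x. (exp (\<tau> * \<phi> x) * u x)\<^sup>2)" for \<tau>
    by (rule integrable_continuous_compact_support[OF _ K(1)])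
       (auto simp: u0 intro!: continuous_intros cu c\<phi>)
  have iD: "integrable lborel (\<lambda>x. (exp (\<tau> * \<phi> x) * D x)\<^sup>2)" for \<tau>
    by (rule integrable_continuous_compact_support[OF _ K(1)])
       (auto simp: D_def Hu0 lin_trace_def intro!: continuous_intros cu c\<phi>)
  have iK: "integrable lborel (indicator K :: 'a \<Rightarrow> real)"
    using borel_integrable_compact[OF K(1), of "\<lambda>_. 1::real"] by simp
  define N where "N = integral\<^sup>L lborel (indicator K :: 'a \<Rightarrow> real)"
  have est: "((1/r) * \<tau>^3 - (4/r)\<^sup>2 * \<tau>\<^sup>2) * I \<tau> \<le> C1\<^sup>2 * I \<tau> + C2\<^sup>2 * exp (- \<tau> * \<delta>) * N" if \<tau>: "0 < \<tau>" for \<tau>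
  proof -
    have "((1/r) * \<tau>^3 - (4/r)\<^sup>2 * \<tau>\<^sup>2) * I \<tau> \<le> integral\<^sup>L lborel (\<lambda>x. (exp (\<tau> * \<phi> x) * D x)\<^sup>2)"
      unfolding I_def D_def
    proof (rule carleman_estimate[OF \<phi>(1) P _ u K(1) u0 \<tau>])
      fix x assume "u x \<noteq> 0"
      then have "x \<in> U" by (auto simp: u_def split: if_splits)
      then show "1/r \<le> 4 * (P (a x) \<bullet> a x) - 2 * (4/r) * (a x \<bullet> a x)"
        using \<rho> by (intro am) (auto simp: U_def dist_commute)
    qed
    also have "\<dots> \<le> integral\<^sup>L lborel (\<lambda>x. C1\<^sup>2 * (exp (\<tau> * \<phi> x) * u x)\<^sup>2 + C2\<^sup>2 * exp (- \<tau> * \<delta>) * indicator K x)"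
    proof (rule integral_mono)
      show "integrable lborel (\<lambda>x. C1\<^sup>2 * (exp (\<tau> * \<phi> x) * u x)\<^sup>2 + C2\<^sup>2 * exp (- \<tau> * \<delta>) * indicator K x)"
        using iI iK by (intro Bochner_Integration.integrable_add integrable_mult_right) auto
      fix x
      \<comment> \<open>Either \<open>u\<close> coincides with \<open>w\<close> and solves the equation, or the weight is small.\<close>
      consider "x \<notin> K" | "x \<in> K" "- \<delta>/2 \<le> \<phi> x" | "x \<in> K" "\<phi> x < - \<delta>/2" by linarith
      then show "(exp (\<tau> * \<phi> x) * D x)\<^sup>2 \<le> C1\<^sup>2 * (exp (\<tau> * \<phi> x) * u x)\<^sup>2 + C2\<^sup>2 * exp (- \<tau> * \<delta>) * indicator K x"
      proof cases
        case 1 then show ?thesis by (simp add: D_def Hu0 lin_trace_def)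
      next
        case 2
        then have x: "x \<in> U" "x \<in> S" using K U by auto
        have "D x = V x * u x" unfolding D_def Hu[OF x(1) 2(2)] uw[OF x(1) 2(2)] by (rule eq[OF x(2)])
        then have "(exp (\<tau> * \<phi> x) * D x)\<^sup>2 = (V x)\<^sup>2 * (exp (\<tau> * \<phi> x) * u x)\<^sup>2"
          by (simp add: power_mult_distrib)
        also have "\<dots> \<le> C1\<^sup>2 * (exp (\<tau> * \<phi> x) * u x)\<^sup>2"
          using C1[OF 2(1)] by (intro mult_right_mono) (auto simp: abs_le_square_iff[symmetric])
        also have "\<dots> \<le> C1\<^sup>2 * (exp (\<tau> * \<phi> x) * u x)\<^sup>2 + C2\<^sup>2 * exp (- \<tau> * \<delta>) * indicator K x" by simp
        finally show ?thesis .
      next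
        case 3
        have "(exp (\<tau> * \<phi> x) * D x)\<^sup>2 = (D x)\<^sup>2 * exp (2 * (\<tau> * \<phi> x))"
          by (simp add: power_mult_distrib exp_double)
        also have "\<dots> \<le> C2\<^sup>2 * exp (- \<tau> * \<delta>)"
        proof (rule mult_mono)
          show "(D x)\<^sup>2 \<le> C2\<^sup>2" using C2[OF 3(1)] by (auto simp: abs_le_square_iff[symmetric])
          have "\<tau> * (2 * \<phi> x) \<le> \<tau> * (- \<delta>)" using \<tau> 3(2) by (intro mult_left_mono) auto
          then show "exp (2 * (\<tau> * \<phi> x)) \<le> exp (- \<tau> * \<delta>)" by simp
        qed auto
        finally show ?thesis using 3 by (simp add: add_increasing)
      qed
    qed (rule iD)
    also have "\<dots> = C1\<^sup>2 * I \<tau> + C2\<^sup>2 * exp (- \<tau> * \<delta>) * N"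
      unfolding I_def N_def using iI iK by (subst Bochner_Integration.integral_add) auto
    finally show ?thesis .
  qed
  have I0: "0 \<le> I \<tau>" for \<tau> unfolding I_def by simp
  have small: "I \<tau> \<le> C2\<^sup>2 * N * exp (- \<tau> * \<delta>)" if \<tau>: "\<tau> \<ge> 16/r + r * (C1\<^sup>2 + 1)" "\<tau> \<ge> 1" for \<tau>
  proof -
    have "C1\<^sup>2 + 1 \<le> \<tau>/r - 16/r\<^sup>2" using \<tau>(1) r by (simp add: field_simps power2_eq_square)
    also have "\<dots> \<le> \<tau>\<^sup>2 * (\<tau>/r - 16/r\<^sup>2)"
    proof -
      have "1 * (\<tau>/r - 16/r\<^sup>2) \<le> \<tau>\<^sup>2 * (\<tau>/r - 16/r\<^sup>2)"
      proof (rule mult_right_mono)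
        show "1 \<le> \<tau>\<^sup>2" using \<tau> by (simp add: one_le_power)
        show "0 \<le> \<tau>/r - 16/r\<^sup>2" using calculation zero_le_power2[of C1] by linarith
      qed
      then show ?thesis by simp
    qed
    also have "\<dots> = (1/r) * \<tau>^3 - (4/r)\<^sup>2 * \<tau>\<^sup>2"
      by (simp add: power2_eq_square power3_eq_cube algebra_simps)
    finally have "(C1\<^sup>2 + 1) * I \<tau> \<le> ((1/r) * \<tau>^3 - (4/r)\<^sup>2 * \<tau>\<^sup>2) * I \<tau>"
      using I0 by (intro mult_right_mono)
    also have "\<dots> \<le> C1\<^sup>2 * I \<tau> + C2\<^sup>2 * exp (- \<tau> * \<delta>) * N" using \<tau> by (intro est) auto
    finally show ?thesis by (simp add: algebra_simps)
  qed
  obtain e0 where e0: "0 < e0" "\<And>x. dist x p < e0 \<Longrightarrow> - \<delta>/4 < \<phi> x"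
  proof -
    have "open (\<phi> -` {- \<delta>/4 <..})" using c\<phi> by (intro open_vimage) auto
    moreover have "p \<in> \<phi> -` {- \<delta>/4 <..}" using \<phi> \<delta> by simp
    ultimately obtain e0 where "0 < e0" "ball p e0 \<subseteq> \<phi> -` {- \<delta>/4 <..}" by (meson openE)
    then show thesis using that[of e0] by (auto simp: subset_iff dist_commute)
  qed
  define e where "e = min e0 \<rho>"
  have e: "0 < e" "ball p e \<subseteq> U" using e0 \<rho> by (auto simp: e_def U_def)
  have "w x0 = 0" if x0: "x0 \<in> ball p e" for x0
  proof (rule ccontr)
    assume nz: "w x0 \<noteq> 0"
    define k where "k = (w x0)\<^sup>2 / 2"
    have k: "0 < k" using nz by (simp add: k_def)
    have "continuous_on (ball p e) (\<lambda>x. (w x)\<^sup>2)"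
      using e U by (intro continuous_intros continuous_on_subset[OF C2_onD(4)[OF w]]) auto
    then have "open (ball p e \<inter> (\<lambda>x. (w x)\<^sup>2) -` {k<..})"
      by (intro continuous_open_preimage) auto
    moreover have "x0 \<in> ball p e \<inter> (\<lambda>x. (w x)\<^sup>2) -` {k<..}" using x0 nz by (simp add: k_def)
    ultimately obtain d where d: "0 < d" "ball x0 d \<subseteq> ball p e \<inter> (\<lambda>x. (w x)\<^sup>2) -` {k<..}"
      by (meson openE)
    define v where "v = integral\<^sup>L lborel (indicator (ball x0 d) :: 'a \<Rightarrow> real)"
    have v: "0 < v" using content_ball_pos[OF d(1), of x0] by (simp add: v_def)
    have iB: "integrable lborel (indicator (ball x0 d) :: 'a \<Rightarrow> real)"
      using emeasure_lborel_ball_finite[of x0 d] by (simp add: integrable_indicator_iff)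
    have low: "exp (- \<tau> * \<delta> / 2) * k * v \<le> I \<tau>" if \<tau>: "0 < \<tau>" for \<tau>
    proof -
      have "exp (- \<tau> * \<delta> / 2) * k * v = integral\<^sup>L lborel (\<lambda>x. exp (- \<tau> * \<delta> / 2) * k * indicator (ball x0 d) x)"
        by (simp add: v_def)
      also have "\<dots> \<le> I \<tau>" unfolding I_def
      proof (rule integral_mono)
        show "integrable lborel (\<lambda>x. exp (- \<tau> * \<delta> / 2) * k * indicator (ball x0 d) x)" using iB by simp
        fix x
        show "exp (- \<tau> * \<delta> / 2) * k * indicator (ball x0 d) x \<le> (exp (\<tau> * \<phi> x) * u x)\<^sup>2"
        proof (cases "x \<in> ball x0 d")
          case True
          then have x: "x \<in> ball p e" "k < (w x)\<^sup>2" using d by auto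
          then have \<phi>x: "- \<delta>/4 < \<phi> x" and xU: "x \<in> U" using e0 e by (auto simp: e_def dist_commute)
          then have ux: "u x = w x" using \<delta> by (intro uw) auto
          have "exp (- \<tau> * \<delta> / 2) * k \<le> exp (2 * (\<tau> * \<phi> x)) * (w x)\<^sup>2"
          proof (rule mult_mono)
            have "\<tau> * (- \<delta>/2) \<le> \<tau> * (2 * \<phi> x)" using \<tau> \<phi>x by (intro mult_left_mono) auto
            then show "exp (- \<tau> * \<delta> / 2) \<le> exp (2 * (\<tau> * \<phi> x))" by simp
          qed (use x k in auto)
          then show ?thesis using True by (simp add: ux power_mult_distrib exp_double)
        qed auto
      qed (rule iI)
      finally show ?thesis .
    qed
    have bound: "k * v \<le> C2\<^sup>2 * N * exp (- (\<tau> * (\<delta>/2)))" if \<tau>: "\<tau> \<ge> 16/r + r * (C1\<^sup>2 + 1)" "\<tau> \<ge> 1" for \<tau>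
    proof -
      have "exp (- \<tau> * \<delta> / 2) * (k * v) \<le> C2\<^sup>2 * N * exp (- \<tau> * \<delta>)"
        using low[of \<tau>] small[OF \<tau>] \<tau> by (simp add: mult.assoc)
      also have "exp (- \<tau> * \<delta>) = exp (- \<tau> * \<delta> / 2) * exp (- (\<tau> * (\<delta>/2)))"
        by (simp add: exp_add[symmetric])
      finally have "exp (- \<tau> * \<delta> / 2) * (k * v) \<le> exp (- \<tau> * \<delta> / 2) * (C2\<^sup>2 * N * exp (- (\<tau> * (\<delta>/2))))"
        by (simp add: mult_ac)
      then show ?thesis by (simp only: mult_le_cancel_left_pos exp_gt_zero)
    qed
    have "((\<lambda>\<tau>. C2\<^sup>2 * N * exp (- (\<tau> * (\<delta>/2)))) \<longlongrightarrow> C2\<^sup>2 * N * 0) at_top"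
    proof (intro tendsto_mult tendsto_const filterlim_compose[OF exp_at_bot])
      show "LIM \<tau> at_top. - (\<tau> * (\<delta>/2)) :> at_bot"
        unfolding filterlim_uminus_at_bot minus_minus
        by (rule filterlim_at_top_mult_tendsto_pos[OF tendsto_const]) (use \<delta> in \<open>auto intro: filterlim_ident\<close>)
    qed
    moreover have "\<forall>\<^sub>F \<tau> in at_top. k * v \<le> C2\<^sup>2 * N * exp (- (\<tau> * (\<delta>/2)))"
      by (rule eventually_mono[OF eventually_ge_at_top[of "max 1 (16/r + r * (C1\<^sup>2 + 1))"]])
         (rule bound, auto)
    ultimately have "k * v \<le> C2\<^sup>2 * N * 0"
      by (rule tendsto_lowerbound) simp
    then have "k * v \<le> 0" by simp
    with k v show False by (simp add: mult_le_0_iff)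
  qed
  with e U show ?thesis by (intro exI[of _ e]) auto
qed

text \<open>
  If the interior \<open>Z\<close> of the zero set were not closed in \<open>S\<close>, then a largest ball in
  \<open>Z\<close> about a point close to its boundary would touch the complement of \<open>Z\<close> at a point of
  \<open>S\<close>, and \<open>w\<close> would vanish near that point as well.
\<close>

lemma weak_unique_continuation:
  fixes w :: "'a::euclidean_space \<Rightarrow> real"
  assumes S: "open S" "connected S" and w: "C2_on S w g H" and V: "continuous_on S V"
    and eq: "\<And>x. x \<in> S \<Longrightarrow> lin_trace (H x) = V x * w x"
    and N: "open N" "N \<noteq> {}" "N \<subseteq> S" "\<And>x. x \<in> N \<Longrightarrow> w x = 0"
    and x: "x \<in> S"
  shows "w x = 0"
proof -
  define Z where "Z = interior {x \<in> S. w x = 0}"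
  have ZS: "Z \<subseteq> S" "\<And>x. x \<in> Z \<Longrightarrow> w x = 0" using interior_subset by (auto simp: Z_def)
  have oZ: "open Z" by (simp add: Z_def)
  have "N \<subseteq> Z" unfolding Z_def by (rule interior_maximal) (use N in auto)
  have "p0 \<in> Z" if p0: "p0 \<in> S" "p0 \<in> closure Z" for p0
  proof (rule ccontr)
    assume nz: "p0 \<notin> Z"
    obtain R where R: "0 < R" "ball p0 R \<subseteq> S" using S p0 by (meson openE)
    \<comment> \<open>The radius \<open>R/2\<close> keeps the touching point inside \<open>ball p0 R\<close>.\<close>
    obtain y where y: "y \<in> Z" "dist y p0 < R/2"
      using p0(2) R unfolding closure_approachable by (metis half_gt_zero)
    obtain p where p: "p \<in> - Z" "\<And>q. q \<in> - Z \<Longrightarrow> dist y p \<le> dist y q"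
      using distance_attains_inf[of "- Z" y] oZ nz by (auto simp: closed_Compl)
    have "dist y p \<le> dist y p0" using p nz by auto
    then have "dist p0 p < R" using y dist_triangle[of p0 p y] by (simp add: dist_commute)
    then have pS: "p \<in> S" using R by auto
    have "0 < dist p y" using y p by auto
    moreover have "w x = 0" if "x \<in> S" "dist x y < dist p y" for x
      using p(2)[of x] that ZS(2)[of x] by (force simp: dist_commute)
    ultimately obtain e where "e > 0" "ball p e \<subseteq> S" "\<forall>x\<in>ball p e. w x = 0"
      using unique_continuation_touching_ball[OF S(1) w V eq pS _ refl] by blast
    then have "ball p e \<subseteq> Z" unfolding Z_def by (intro interior_maximal) auto
    with \<open>e > 0\<close> p(1) show False using centre_in_ball[of p e] by blast
  qed
  then have "Z = S \<inter> closure Z" using ZS closure_subset by blast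
  then have "closedin (top_of_set S) Z" by (metis closed_closure closedin_closed_Int)
  moreover have "openin (top_of_set S) Z" using oZ ZS by (simp add: open_subset)
  ultimately have "Z = {} \<or> Z = S" using S(2) by (auto simp: connected_clopen)
  with \<open>N \<subseteq> Z\<close> N have "Z = S" by auto
  with x ZS show ?thesis by auto
qed

section \<open>Proportionality of solutions on a cone\<close>

lemma C2_on_lincomb:
  fixes f f' :: "'a::euclidean_space \<Rightarrow> real"
  assumes f: "C2_on S f g H" and f': "C2_on S f' g' H'"
  shows "C2_on S (\<lambda>x. \<alpha> * f x + \<beta> * f' x) (\<lambda>x. \<alpha> *\<^sub>R g x + \<beta> *\<^sub>R g' x) (\<lambda>x h. \<alpha> *\<^sub>R H x h + \<beta> *\<^sub>R H' x h)"
  unfolding C2_on_def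
proof (intro conjI ballI allI)
  note d = C2_onD[OF f] and d' = C2_onD[OF f']
  fix x assume x: "x \<in> S"
  show "((\<lambda>x. \<alpha> * f x + \<beta> * f' x) has_derivative (\<lambda>h. (\<alpha> *\<^sub>R g x + \<beta> *\<^sub>R g' x) \<bullet> h)) (at x)"
    by (rule has_derivative_eq_rhs[OF has_derivative_add[OF has_derivative_mult_right[OF d(1)[OF x]]
            has_derivative_mult_right[OF d'(1)[OF x]]]]) (simp add: inner_simps)
  show "((\<lambda>x. \<alpha> *\<^sub>R g x + \<beta> *\<^sub>R g' x) has_derivative (\<lambda>h. \<alpha> *\<^sub>R H x h + \<beta> *\<^sub>R H' x h)) (at x)"
    by (intro has_derivative_add has_derivative_scaleR_right d(2) d'(2) x)
next
  fix h show "continuous_on S (\<lambda>x. \<alpha> *\<^sub>R H x h + \<beta> *\<^sub>R H' x h)"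
    by (intro continuous_intros C2_onD(3)[OF f] C2_onD(3)[OF f'])
qed

text \<open>
  Three solutions of the same equation \<open>\<Delta>f = V f\<close> that satisfy \<open>d\<^sup>2 + e\<^sup>2 = \<kappa> c\<^sup>2\<close>.
  In the director picture \<open>(d, e) = sqrt \<kappa> c u\<close> with a unit vector \<open>u\<close>, and the
  Laplacian forces \<open>c |\<nabla>u|\<^sup>2 = 0\<close>. The proof avoids \<open>u\<close>: the Laplacian of the
  constraint gives \<open>|\<nabla>d|\<^sup>2 + |\<nabla>e|\<^sup>2 = \<kappa> |\<nabla>c|\<^sup>2\<close>, because the terms with
  \<open>V\<close> add up to \<open>V\<close> times the constraint. Together with the gradient of the constraint
  this is the equality case of the Cauchy-Schwarz inequality and yields
  \<open>e \<nabla>d = d \<nabla>e\<close>. Then \<open>d/c\<close> and \<open>e/c\<close> have gradient zero.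
\<close>

lemma proportional_on_connected:
  fixes c d e :: "'a::euclidean_space \<Rightarrow> real"
  assumes S: "open S" "connected S"
    and c: "C2_on S c gc Hc" and d: "C2_on S d gd Hd" and e: "C2_on S e ge He"
    and eqs: "\<And>x. x \<in> S \<Longrightarrow> lin_trace (Hc x) = V x * c x"
       "\<And>x. x \<in> S \<Longrightarrow> lin_trace (Hd x) = V x * d x"
       "\<And>x. x \<in> S \<Longrightarrow> lin_trace (He x) = V x * e x"
    and cone: "\<And>x. x \<in> S \<Longrightarrow> (d x)\<^sup>2 + (e x)\<^sup>2 = \<kappa> * (c x)\<^sup>2" and \<kappa>: "0 < \<kappa>"
    and c0: "\<And>x. x \<in> S \<Longrightarrow> c x \<noteq> 0"
  shows "\<exists>\<alpha> \<beta>. \<forall>x\<in>S. d x = \<alpha> * c x \<and> e x = \<beta> * c x"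
proof -
  note cD = C2_onD[OF c] and dD = C2_onD[OF d] and eD = C2_onD[OF e]
  \<comment> \<open>Half the gradient of the constraint.\<close>
  define G where "G x = d x *\<^sub>R gd x + e x *\<^sub>R ge x - (\<kappa> * c x) *\<^sub>R gc x" for x
  have G0: "G x = 0" if x: "x \<in> S" for x
  proof -
    have "((\<lambda>x. d x * d x + e x * e x - \<kappa> * (c x * c x)) has_derivative (\<lambda>h. (2 *\<^sub>R G x) \<bullet> h)) (at x)"
      by (rule has_derivative_eq_rhs, (rule derivative_intros cD(1)[OF x] dD(1)[OF x] eD(1)[OF x])+)
         (auto simp: fun_eq_iff G_def inner_simps algebra_simps)
    from has_derivative_zero_outside[OF this S(1) x]
    have "(\<lambda>h. (2 *\<^sub>R G x) \<bullet> h) = (\<lambda>h. 0)" using cone by (auto simp: power2_eq_square)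
    then show ?thesis by (auto simp: fun_eq_iff dest: spec[of _ "G x"])
  qed
  have cross: "e x *\<^sub>R gd x = d x *\<^sub>R ge x" if x: "x \<in> S" for x
  proof -
    define D where "D h = (gd x \<bullet> h) *\<^sub>R gd x + d x *\<^sub>R Hd x h + ((ge x \<bullet> h) *\<^sub>R ge x + e x *\<^sub>R He x h)
       - \<kappa> *\<^sub>R ((gc x \<bullet> h) *\<^sub>R gc x + c x *\<^sub>R Hc x h)" for h
    have "(G has_derivative D) (at x)"
      unfolding G_def[abs_def] D_def[abs_def]
      by (rule has_derivative_eq_rhs,
         (rule derivative_intros cD(1)[OF x] dD(1)[OF x] eD(1)[OF x] cD(2)[OF x] dD(2)[OF x] eD(2)[OF x])+)
         (auto simp: fun_eq_iff algebra_simps)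
    then have "D = (\<lambda>h. 0)" using G0 S x by (auto intro: has_derivative_zero_outside[of G])
    then have "lin_trace D = 0" by (simp add: lin_trace_def)
    moreover have "lin_trace D = gd x \<bullet> gd x + ge x \<bullet> ge x - \<kappa> * (gc x \<bullet> gc x)
      + V x * ((d x)\<^sup>2 + (e x)\<^sup>2 - \<kappa> * (c x)\<^sup>2)"
      unfolding D_def[abs_def]
      by (simp del: scaleR_scaleR add: lin_trace_add lin_trace_diff lin_trace_scaleR lin_trace_inner eqs x)
         (simp add: algebra_simps power2_eq_square)
    ultimately have grads: "gd x \<bullet> gd x + ge x \<bullet> ge x = \<kappa> * (gc x \<bullet> gc x)" using cone[OF x] by simp
    have lin: "d x *\<^sub>R gd x + e x *\<^sub>R ge x = (\<kappa> * c x) *\<^sub>R gc x" using G0[OF x] by (simp add: G_def)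
    define X where "X = e x *\<^sub>R gd x - d x *\<^sub>R ge x"
    \<comment> \<open>Lagrange's identity for the two gradients.\<close>
    have "X \<bullet> X + (d x *\<^sub>R gd x + e x *\<^sub>R ge x) \<bullet> (d x *\<^sub>R gd x + e x *\<^sub>R ge x)
       = ((d x)\<^sup>2 + (e x)\<^sup>2) * (gd x \<bullet> gd x + ge x \<bullet> ge x)"
      by (simp add: X_def inner_simps inner_commute power2_eq_square algebra_simps)
    also have "\<dots> = (\<kappa> * (c x)\<^sup>2) * (\<kappa> * (gc x \<bullet> gc x))" using cone[OF x] grads by simp
    also have "\<dots> = (d x *\<^sub>R gd x + e x *\<^sub>R ge x) \<bullet> (d x *\<^sub>R gd x + e x *\<^sub>R ge x)"
      unfolding lin by (simp add: power2_eq_square)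
    finally have "X = 0" by simp
    then show ?thesis by (simp add: X_def)
  qed
  have parallel: "c x *\<^sub>R gd x = d x *\<^sub>R gc x" "c x *\<^sub>R ge x = e x *\<^sub>R gc x" if x: "x \<in> S" for x
  proof -
    have lin: "d x *\<^sub>R gd x + e x *\<^sub>R ge x = (\<kappa> * c x) *\<^sub>R gc x" using G0[OF x] by (simp add: G_def)
    have kc: "\<kappa> * c x \<noteq> 0" using \<kappa> c0[OF x] by simp
    have "(\<kappa> * c x) *\<^sub>R (c x *\<^sub>R gd x) = ((d x)\<^sup>2 + (e x)\<^sup>2) *\<^sub>R gd x"
      using cone[OF x] by (simp add: power2_eq_square mult_ac)
    also have "\<dots> = d x *\<^sub>R (d x *\<^sub>R gd x) + e x *\<^sub>R (e x *\<^sub>R gd x)"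
      by (simp add: power2_eq_square scaleR_left_distrib)
    also have "\<dots> = d x *\<^sub>R (d x *\<^sub>R gd x + e x *\<^sub>R ge x)"
      unfolding cross[OF x] by (simp add: scaleR_right_distrib mult.commute)
    also have "\<dots> = (\<kappa> * c x) *\<^sub>R (d x *\<^sub>R gc x)" unfolding lin by (simp add: mult_ac)
    finally show "c x *\<^sub>R gd x = d x *\<^sub>R gc x" using kc by (simp only: scaleR_cancel_left) simp
    have "(\<kappa> * c x) *\<^sub>R (c x *\<^sub>R ge x) = ((d x)\<^sup>2 + (e x)\<^sup>2) *\<^sub>R ge x"
      using cone[OF x] by (simp add: power2_eq_square mult_ac)
    also have "\<dots> = d x *\<^sub>R (d x *\<^sub>R ge x) + e x *\<^sub>R (e x *\<^sub>R ge x)"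
      by (simp add: power2_eq_square scaleR_left_distrib)
    also have "\<dots> = e x *\<^sub>R (d x *\<^sub>R gd x + e x *\<^sub>R ge x)"
      unfolding cross[OF x, symmetric] by (simp add: scaleR_right_distrib mult.commute)
    also have "\<dots> = (\<kappa> * c x) *\<^sub>R (e x *\<^sub>R gc x)" unfolding lin by (simp add: mult_ac)
    finally show "c x *\<^sub>R ge x = e x *\<^sub>R gc x" using kc by (simp only: scaleR_cancel_left) simp
  qed
  have ratio: "((\<lambda>x. f x / c x) has_derivative (\<lambda>h. 0)) (at x)"
    if x: "x \<in> S" and f: "(f has_derivative (\<lambda>h. gf x \<bullet> h)) (at x)" and p: "c x *\<^sub>R gf x = f x *\<^sub>R gc x" for f gf x
  proof (rule has_derivative_eq_rhs[OF has_derivative_divide[OF f cD(1)[OF x] c0[OF x]]])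
    have "(gf x \<bullet> h) * c x = f x * (gc x \<bullet> h)" for h
      using arg_cong[OF p, of "\<lambda>z. z \<bullet> h"] by (simp add: mult.commute)
    then show "(\<lambda>h. - f x * (inverse (c x) * (gc x \<bullet> h) * inverse (c x)) + gf x \<bullet> h / c x) = (\<lambda>h. 0)"
      using c0[OF x] by (auto simp: fun_eq_iff field_simps)
  qed
  have r: "((\<lambda>x. d x / c x) has_derivative (\<lambda>h. 0)) (at x)" "((\<lambda>x. e x / c x) has_derivative (\<lambda>h. 0)) (at x)"
    if x: "x \<in> S" for x
    using ratio[where f = d and gf = gd, OF x dD(1)[OF x] parallel(1)[OF x]]
      ratio[where f = e and gf = ge, OF x eD(1)[OF x] parallel(2)[OF x]] by blast+
  show ?thesis
  proof (cases "S = {}")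
    case False
    then obtain x0 where x0: "x0 \<in> S" by auto
    have "d x / c x = d x0 / c x0 \<and> e x / c x = e x0 / c x0" if x: "x \<in> S" for x
    proof
      show "d x / c x = d x0 / c x0"
        by (rule has_derivative_zero_unique_connected[OF S _ x x0]) (rule r)
      show "e x / c x = e x0 / c x0"
        by (rule has_derivative_zero_unique_connected[OF S _ x x0]) (rule r)
    qed
    then have "d x = d x0 / c x0 * c x \<and> e x = e x0 / c x0 * c x" if "x \<in> S" for x
      using that c0[OF that] by (metis nonzero_divide_eq_eq)
    then show ?thesis by blast
  qed auto
qed

section \<open>The tensor field in its components\<close>

lemma Ck_on_2_imp_C2_on:
  assumes S: "open S" and f: "Ck_on 2 S f"
  shows "\<exists>g H. C2_on S f g H \<and> (\<forall>x\<in>S. lin_trace (H x) = laplacian f x)"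
proof -
  have f2: "\<And>x. x \<in> S \<Longrightarrow> f differentiable at x"
    "\<And>x i. x \<in> S \<Longrightarrow> partial_deriv i f differentiable at x"
    "\<And>i j. continuous_on S (partial_deriv i (partial_deriv j f))"
    using f by (auto simp: numeral_2_eq_2)
  have rep: "frechet_derivative F (at x) h = (\<chi> i. partial_deriv i F x) \<bullet> h"
    if "F differentiable at x" for F x and h :: "real^3"
  proof -
    have l: "linear (frechet_derivative F (at x))"
      using that by (simp add: linear_frechet_derivative)
    have "frechet_derivative F (at x) h = frechet_derivative F (at x) (\<Sum>i\<in>UNIV. h $ i *\<^sub>R axis i 1)"
      by (simp only: basis_expansion[of h, unfolded scalar_mult_eq_scaleR])
    also have "\<dots> = (\<Sum>i\<in>UNIV. h $ i * partial_deriv i F x)"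
      by (simp add: linear_sum[OF l] linear_cmul[OF l] partial_deriv_def)
    finally show ?thesis by (simp add: inner_vec_def mult.commute)
  qed
  have der: "(F has_derivative (\<lambda>h. (\<chi> i. partial_deriv i F x) \<bullet> h)) (at x)"
    if "F differentiable at x" for F x
    using that rep[OF that] by (metis (no_types, lifting) ext frechet_derivative_works)
  define g where "g x = (\<chi> i. partial_deriv i f x)" for x
  define H where "H x h = (\<chi> i. (\<chi> j. partial_deriv j (partial_deriv i f) x) \<bullet> h)" for x h
  have "C2_on S f g H"
    unfolding C2_on_def
  proof (intro conjI ballI allI)
    fix x assume x: "x \<in> S"
    show "(f has_derivative (\<lambda>h. g x \<bullet> h)) (at x)" unfolding g_def by (rule der[OF f2(1)[OF x]])
    show "(g has_derivative H x) (at x)"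
      unfolding has_derivative_componentwise_within[of g]
    proof
      fix b :: "real^3" assume "b \<in> Basis"
      then obtain i where b: "b = axis i 1" by (auto simp: Basis_vec_def)
      show "((\<lambda>x. g x \<bullet> b) has_derivative (\<lambda>h. H x h \<bullet> b)) (at x)"
        unfolding b inner_axis g_def H_def using der[OF f2(2)[OF x, of i]] by simp
    qed
  next
    fix h show "continuous_on S (\<lambda>x. H x h)"
      unfolding H_def by (intro continuous_intros f2(3))
  qed
  moreover have "lin_trace (H x) = laplacian f x" for x
  proof -
    have B: "(Basis :: (real^3) set) = range (\<lambda>i. axis i 1)" by (auto simp: Basis_vec_def)
    have "lin_trace (H x) = (\<Sum>i\<in>UNIV. H x (axis i 1) \<bullet> axis i 1)"
      unfolding lin_trace_def B by (subst sum.reindex) (auto simp: inj_on_def axis_eq_axis)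
    then show ?thesis by (simp add: H_def inner_axis laplacian_def)
  qed
  ultimately show ?thesis by blast
qed

text \<open>
  A traceless symmetric 2 by 2 block with entries \<open>m cos (2\<theta>)\<close> and
  \<open>m sin (2\<theta>)\<close> is diagonalised by the rotation with angle \<open>\<theta>\<close>, so the frame
  depends on \<open>\<theta>\<close> alone.
\<close>

lemma constant_eigenframe_rotation:
  assumes Q: "\<And>x. x \<in> U \<Longrightarrow> Q x $ 1 $ 1 = m x * cos (2 * \<theta>) - l x / 2 \<and>
        Q x $ 2 $ 2 = - (m x * cos (2 * \<theta>)) - l x / 2 \<and> Q x $ 3 $ 3 = l x \<and>
        Q x $ 1 $ 2 = m x * sin (2 * \<theta>) \<and> Q x $ 2 $ 1 = m x * sin (2 * \<theta>) \<and>
        Q x $ 1 $ 3 = 0 \<and> Q x $ 3 $ 1 = 0 \<and> Q x $ 2 $ 3 = 0 \<and> Q x $ 3 $ 2 = 0"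
  shows "constant_eigenframe Q U"
proof -
  define C where "C = cos \<theta>"
  define S where "S = sin \<theta>"
  have CS: "C * C + S * S = 1" unfolding C_def S_def by (metis sin_cos_squared_add3)
  have c2: "cos (2 * \<theta>) = C * C - S * S" "sin (2 * \<theta>) = 2 * S * C"
    by (simp_all add: C_def S_def cos_double sin_double power2_eq_square)
  define v1 v2 v3 :: "real^3" where "v1 = vector [C, S, 0]" and "v2 = vector [- S, C, 0]" and "v3 = vector [0, 0, 1]"
  note v = v1_def v2_def v3_def
  have ip: "v1 \<bullet> v1 = 1" "v2 \<bullet> v2 = 1" "v3 \<bullet> v3 = 1" "v1 \<bullet> v2 = 0" "v1 \<bullet> v3 = 0" "v2 \<bullet> v3 = 0"
    using CS by (auto simp: v inner_vec_def sum_3 algebra_simps)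
  have "x \<in> span {v1, v2, v3}" for x
  proof -
    have "x = (x \<bullet> v1) *\<^sub>R v1 + (x \<bullet> v2) *\<^sub>R v2 + (x \<bullet> v3) *\<^sub>R v3"
    proof -
      have "x $ 1 = (x $ 1) * (C * C + S * S)" "x $ 2 = (x $ 2) * (C * C + S * S)" using CS by auto
      then show ?thesis
        by (simp add: vec_eq_iff forall_3 v inner_vec_def sum_3 algebra_simps)
    qed
    also have "\<dots> \<in> span {v1, v2, v3}"
      by (intro span_add span_mul span_base) auto
    finally show ?thesis .
  qed
  moreover have "\<exists>l. Q x *v v = l *\<^sub>R v" if x: "x \<in> U" and v': "v \<in> {v1, v2, v3}" for x v
  proof -
    note q = Q[OF x, unfolded c2]
    have C1: "(C * C - S * S) * C + 2 * S * C * S = C" "2 * S * C * C - (C * C - S * S) * S = S"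
    proof -
      have "(C * C - S * S) * C + 2 * S * C * S = C * (C * C + S * S)" by (simp add: algebra_simps)
      then show "(C * C - S * S) * C + 2 * S * C * S = C" using CS by simp
      have "2 * S * C * C - (C * C - S * S) * S = S * (C * C + S * S)" by (simp add: algebra_simps)
      then show "2 * S * C * C - (C * C - S * S) * S = S" using CS by simp
    qed
    define A where "A = m x * (C * C - S * S)"
    define B where "B = m x * (2 * S * C)"
    have q': "Q x $ 1 $ 1 = A - l x / 2" "Q x $ 2 $ 2 = - A - l x / 2" "Q x $ 3 $ 3 = l x"
        "Q x $ 1 $ 2 = B" "Q x $ 2 $ 1 = B" "Q x $ 1 $ 3 = 0" "Q x $ 3 $ 1 = 0" "Q x $ 2 $ 3 = 0" "Q x $ 3 $ 2 = 0"
      using q unfolding A_def B_def by blast+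
    have act: "(Q x *v w) $ 1 = (A - l x / 2) * w $ 1 + B * w $ 2"
      "(Q x *v w) $ 2 = B * w $ 1 + (- A - l x / 2) * w $ 2" "(Q x *v w) $ 3 = l x * w $ 3" for w
      unfolding matrix_vector_mult_def by (simp_all add: sum_3 q')
    have "A * C + B * S = m x * ((C * C - S * S) * C + 2 * S * C * S)"
      "B * C - A * S = m x * (2 * S * C * C - (C * C - S * S) * S)"
      unfolding A_def B_def by (simp_all only: algebra_simps)
    then have AB: "A * C + B * S = m x * C" "B * C - A * S = m x * S" by (simp_all only: C1)
    have "(A - l x / 2) * C + B * S = (m x - l x / 2) * C" "B * C + (- A - l x / 2) * S = (m x - l x / 2) * S"
      "(A - l x / 2) * (- S) + B * C = (- m x - l x / 2) * (- S)" "B * (- S) + (- A - l x / 2) * C = (- m x - l x / 2) * C"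
      unfolding left_diff_distrib using AB by linarith+
    then have "Q x *v v1 = (m x - l x / 2) *\<^sub>R v1" "Q x *v v2 = (- m x - l x / 2) *\<^sub>R v2" "Q x *v v3 = l x *\<^sub>R v3"
      unfolding vec_eq_iff forall_3 act by (simp_all add: v)
    with v' show ?thesis by blast
  qed
  moreover have "pairwise orthogonal {v1, v2, v3}"
    using ip by (auto simp: pairwise_def orthogonal_def inner_commute)
  moreover have "\<forall>v\<in>{v1, v2, v3}. norm v = 1" using ip by (auto simp: norm_eq_1)
  ultimately show ?thesis unfolding constant_eigenframe_def
    by (intro exI[of _ "{v1, v2, v3}"]) auto
qed

lemma q_tensor_entries:
  assumes "X = q1 *\<^sub>R E\<^sub>1 + q2 *\<^sub>R E\<^sub>2 + q3 *\<^sub>R E\<^sub>3"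
  shows "X $ 1 $ 3 = 0" "X $ 3 $ 1 = 0" "X $ 2 $ 3 = 0" "X $ 3 $ 2 = 0" "X $ 2 $ 1 = X $ 1 $ 2"
    "X $ 1 $ 1 + X $ 2 $ 2 + X $ 3 $ 3 = 0"
  unfolding assms
  by (simp_all add: E\<^sub>1_def E\<^sub>2_def E\<^sub>3_def tensor_prod_def axis_def mat_def algebra_simps)

text \<open>
  If \<open>e\<^sub>z\<close> is an eigenvector and \<open>s \<noteq> 0\<close>, then the director is either vertical or horizontal.
  In the second case \<open>X $ 3 $ 3 = - s/3\<close>, and half the difference of the planar eigenvalues \<open>2s/3\<close>
  and \<open>-s/3\<close> is \<open>s/2\<close>; this is where the factor 9/4 comes from.
\<close>

lemma uniaxial_dichotomy:
  fixes n :: "real^3"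
  assumes n: "norm n = 1" and X: "X = s *\<^sub>R (n \<otimes> n - (1/3) *\<^sub>R mat 1)"
    and z: "X $ 1 $ 3 = 0" "X $ 2 $ 3 = 0"
  shows "(X $ 1 $ 1 = X $ 2 $ 2 \<and> X $ 1 $ 2 = 0) \<or>
    ((X $ 1 $ 1 - X $ 2 $ 2) / 2)\<^sup>2 + (X $ 1 $ 2)\<^sup>2 = 9/4 * (X $ 3 $ 3)\<^sup>2"
proof -
  have nn: "n $ 1 * n $ 1 + n $ 2 * n $ 2 + n $ 3 * n $ 3 = 1"
    using n by (simp add: norm_eq_1 inner_vec_def sum_3)
  have X': "X $ 1 $ 1 = s * (n $ 1 * n $ 1 - 1/3)" "X $ 2 $ 2 = s * (n $ 2 * n $ 2 - 1/3)"
    "X $ 3 $ 3 = s * (n $ 3 * n $ 3 - 1/3)" "X $ 1 $ 2 = s * (n $ 1 * n $ 2)"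
    "X $ 1 $ 3 = s * (n $ 1 * n $ 3)" "X $ 2 $ 3 = s * (n $ 2 * n $ 3)"
    by (simp_all add: X tensor_prod_def mat_def)
  consider "s = 0" | "n $ 3 = 0" | "n $ 1 = 0" "n $ 2 = 0"
    using z unfolding X' by auto
  then show ?thesis
  proof cases
    case 2
    then have "n $ 1 * n $ 1 + n $ 2 * n $ 2 = 1" using nn by simp
    have "((X $ 1 $ 1 - X $ 2 $ 2) / 2)\<^sup>2 + (X $ 1 $ 2)\<^sup>2 = s\<^sup>2 * (n $ 1 * n $ 1 + n $ 2 * n $ 2)\<^sup>2 / 4"
      unfolding X' by (simp add: power2_eq_square field_simps)
    also have "\<dots> = 9/4 * (X $ 3 $ 3)\<^sup>2"
      unfolding X' 2 \<open>n $ 1 * n $ 1 + n $ 2 * n $ 2 = 1\<close> by (simp add: power2_eq_square)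
    finally show ?thesis by simp
  qed (simp_all add: X')
qed

text \<open>
  The planar components \<open>d\<close> and \<open>e\<close> always solve a linear equation with the common
  potential \<open>V\<close>. The component \<open>c\<close> solves it where the director is horizontal, since
  there \<open>trace (X ** X) = 6 c\<^sup>2\<close> makes \<open>c\<^sup>2 - trace (X ** X) / 3\<close> equal to
  \<open>- c\<^sup>2\<close>.
\<close>

lemma euler_lagrange_components:
  fixes X :: "real^3^3"
  assumes z: "X $ 1 $ 3 = 0" "X $ 3 $ 1 = 0" "X $ 2 $ 3 = 0" "X $ 3 $ 2 = 0" "X $ 2 $ 1 = X $ 1 $ 2"
     "X $ 1 $ 1 + X $ 2 $ 2 + X $ 3 $ 3 = 0"
    and R: "\<And>i j. R i j = t * X $ i $ j
          - 3 * sqrt 6 * ((\<Sum>k\<in>UNIV. X $ i $ k * X $ k $ j)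
                          - (1/3) * (if i = j then 1 else 0) * trace (X ** X))
          + 2 * X $ i $ j * trace (X ** X)"
    and c: "c = X $ 3 $ 3" and d: "d = (X $ 1 $ 1 - X $ 2 $ 2) / 2" and e: "e = X $ 1 $ 2"
    and V: "V = t + 3 * sqrt 6 * c + 3 * c\<^sup>2 + 4 * (d\<^sup>2 + e\<^sup>2)"
  shows "(R 1 1 - R 2 2) / 2 = V * d" "R 1 2 = V * e" "d\<^sup>2 + e\<^sup>2 = 9/4 * c\<^sup>2 \<Longrightarrow> R 3 3 = V * c"
proof -
  have X: "X $ 1 $ 1 = d - c/2" "X $ 2 $ 2 = - d - c/2" "X $ 3 $ 3 = c" "X $ 1 $ 2 = e" "X $ 2 $ 1 = e"
    using z by (auto simp: c d e field_simps)
  have T: "trace (X ** X) = 3/2 * c\<^sup>2 + 2 * (d\<^sup>2 + e\<^sup>2)"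
    by (simp add: trace_def matrix_matrix_mult_def sum_3 X z(1-4)) (simp add: power2_eq_square field_simps)
  define q where "q = sqrt (6::real)"
  define T' where "T' = trace (X ** X)"
  have V': "V = t + 3 * q * c + 2 * T'" by (simp add: V T'_def T q_def)
  have "R 1 1 = t * (d - c/2) - 3 * q * ((d - c/2) * (d - c/2) + e * e - T'/3) + 2 * (d - c/2) * T'"
    "R 2 2 = t * (- d - c/2) - 3 * q * (e * e + (- d - c/2) * (- d - c/2) - T'/3) + 2 * (- d - c/2) * T'"
    "R 1 2 = t * e - 3 * q * ((d - c/2) * e + e * (- d - c/2)) + 2 * e * T'"
    "R 3 3 = t * c - 3 * q * (c * c - T'/3) + 2 * c * T'"
    unfolding R T'_def[symmetric] q_def[symmetric] by (simp_all add: sum_3 X z(1-4))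
  note R' = this
  show "(R 1 1 - R 2 2) / 2 = V * d" unfolding R' V' by (simp add: field_simps)
  show "R 1 2 = V * e" unfolding R' V' by (simp add: field_simps)
  show "R 3 3 = V * c" if "d\<^sup>2 + e\<^sup>2 = 9/4 * c\<^sup>2"
  proof -
    have "T' = 6 * (c * c)" unfolding T'_def T that by (simp add: power2_eq_square)
    then show ?thesis unfolding R' V' by (simp add: field_simps)
  qed
qed

section \<open>Constant eigenframes of uniaxial solutions\<close>

theorem proposition3p3:
  fixes t :: real
    and \<Omega> :: "(real^3) set"
    and q\<^sub>1 q\<^sub>2 q\<^sub>3 :: "real^3 \<Rightarrow> real"
    and Q :: "real^3 \<Rightarrow> real^3^3"
  assumes "t \<le> 1"
    and "open \<Omega>"
    and "\<And>x. x \<in> \<Omega> \<Longrightarrow> Q x = q\<^sub>1 x *\<^sub>R E\<^sub>1 + q\<^sub>2 x *\<^sub>R E\<^sub>2 + q\<^sub>3 x *\<^sub>R E\<^sub>3"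
    and "uniaxial_on \<Omega> Q"
    and "classical_solution t \<Omega> Q"
  shows "(\<forall>C \<in> components {x \<in> \<Omega>. Q x \<noteq> 0}. constant_eigenframe Q C) \<and>
         (connected \<Omega> \<longrightarrow> constant_eigenframe Q \<Omega>)"
proof -
  define c where "c x = Q x $ 3 $ 3" for x
  define d where "d x = (Q x $ 1 $ 1 - Q x $ 2 $ 2) / 2" for x
  define e where "e x = Q x $ 1 $ 2" for x
  define V where "V x = t + 3 * sqrt 6 * c x + 3 * (c x)\<^sup>2 + 4 * ((d x)\<^sup>2 + (e x)\<^sup>2)" for x
  note entries = q_tensor_entries[OF assms(3)]
  have Q11: "Q x $ 1 $ 1 = d x - c x / 2" "Q x $ 2 $ 2 = - d x - c x / 2" if "x \<in> \<Omega>" for x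
    using entries(6)[OF that] by (auto simp: c_def d_def field_simps)
  have Q0: "Q x = 0" if "x \<in> \<Omega>" "c x = 0" "d x = 0" "e x = 0" for x
    using that entries(1-5)[OF that(1)] Q11[OF that(1)]
    by (simp add: vec_eq_iff forall_3 c_def e_def)
  have dich: "(d x = 0 \<and> e x = 0) \<or> (d x)\<^sup>2 + (e x)\<^sup>2 = 9/4 * (c x)\<^sup>2" if x: "x \<in> \<Omega>" for x
  proof -
    obtain s n where "norm n = 1" "Q x = s *\<^sub>R (n \<otimes> n - (1/3) *\<^sub>R mat 1)"
      using assms(4) x unfolding uniaxial_on_def by blast
    from uniaxial_dichotomy[OF this entries(1)[OF x] entries(3)[OF x]] show ?thesis
      by (simp add: c_def d_def e_def)
  qed
  have "\<exists>g H. C2_on \<Omega> (\<lambda>x. Q x $ i $ j) g H \<and> (\<forall>x\<in>\<Omega>. lin_trace (H x) = laplacian (\<lambda>y. Q y $ i $ j) x)" for i j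
    using assms(5) by (intro Ck_on_2_imp_C2_on assms(2)) (simp add: classical_solution_def)
  then obtain g H where C2: "\<And>i j. C2_on \<Omega> (\<lambda>x. Q x $ i $ j) (g i j) (H i j)"
    and lap: "\<And>i j x. x \<in> \<Omega> \<Longrightarrow> lin_trace (H i j x) = laplacian (\<lambda>y. Q y $ i $ j) x"
    by metis
  have pde: "lin_trace (H i j x) = t * Q x $ i $ j
          - 3 * sqrt 6 * ((\<Sum>k\<in>UNIV. Q x $ i $ k * Q x $ k $ j)
                          - (1/3) * (if i = j then 1 else 0) * trace (Q x ** Q x))
          + 2 * Q x $ i $ j * trace (Q x ** Q x)" if "x \<in> \<Omega>" for i j x
    using assms(5) that unfolding lap[OF that] classical_solution_def by blast
  define gd where "gd = (\<lambda>x. (1/2) *\<^sub>R g 1 1 x + (-1/2) *\<^sub>R g 2 2 x)"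
  define Hd where "Hd = (\<lambda>x h. (1/2) *\<^sub>R H 1 1 x h + (-1/2) *\<^sub>R H 2 2 x h)"
  have C2c: "C2_on \<Omega> c (g 3 3) (H 3 3)" using C2[of 3 3] by (simp add: c_def[abs_def])
  have C2e: "C2_on \<Omega> e (g 1 2) (H 1 2)" using C2[of 1 2] by (simp add: e_def[abs_def])
  have C2d: "C2_on \<Omega> d gd Hd"
  proof -
    have "d = (\<lambda>x. 1/2 * Q x $ 1 $ 1 + - 1/2 * Q x $ 2 $ 2)" by (auto simp: d_def)
    then show ?thesis using C2_on_lincomb[OF C2[of 1 1] C2[of 2 2], of "1/2" "-1/2"]
      by (simp add: gd_def Hd_def)
  qed
  have eqd: "lin_trace (Hd x) = V x * d x" and eqe: "lin_trace (H 1 2 x) = V x * e x"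
    and eqc: "(d x)\<^sup>2 + (e x)\<^sup>2 = 9/4 * (c x)\<^sup>2 \<Longrightarrow> lin_trace (H 3 3 x) = V x * c x" if x: "x \<in> \<Omega>" for x
  proof -
    note eqs = euler_lagrange_components[of "Q x" "\<lambda>i j. lin_trace (H i j x)",
        OF entries(1)[OF x] entries(2)[OF x] entries(3)[OF x] entries(4)[OF x] entries(5)[OF x] entries(6)[OF x]
          pde[OF x] c_def d_def e_def V_def]
    show "lin_trace (Hd x) = V x * d x"
      using eqs(1) by (simp add: Hd_def lin_trace_add lin_trace_scaleR lin_trace_diff)
    show "lin_trace (H 1 2 x) = V x * e x" using eqs(2) .
    show "lin_trace (H 3 3 x) = V x * c x" if "(d x)\<^sup>2 + (e x)\<^sup>2 = 9/4 * (c x)\<^sup>2" using eqs(3)[OF that] .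
  qed
  have cc: "continuous_on \<Omega> c" "continuous_on \<Omega> d" "continuous_on \<Omega> e"
    using C2_onD(4)[OF C2c] C2_onD(4)[OF C2d] C2_onD(4)[OF C2e] .
  then have cV: "continuous_on \<Omega> V" unfolding V_def[abs_def] by (intro continuous_intros)
  have frame: "constant_eigenframe Q U"
    if U: "U \<subseteq> \<Omega>" and de: "\<And>x. x \<in> U \<Longrightarrow> d x = m x * cos (2 * \<theta>) \<and> e x = m x * sin (2 * \<theta>)" for U m \<theta>
  proof (rule constant_eigenframe_rotation[of U Q m \<theta> c])
    fix x assume "x \<in> U"
    then have x: "x \<in> \<Omega>" "d x = m x * cos (2 * \<theta>)" "e x = m x * sin (2 * \<theta>)" using U de by auto
    show "Q x $ 1 $ 1 = m x * cos (2 * \<theta>) - c x / 2 \<and>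
        Q x $ 2 $ 2 = - (m x * cos (2 * \<theta>)) - c x / 2 \<and> Q x $ 3 $ 3 = c x \<and>
        Q x $ 1 $ 2 = m x * sin (2 * \<theta>) \<and> Q x $ 2 $ 1 = m x * sin (2 * \<theta>) \<and>
        Q x $ 1 $ 3 = 0 \<and> Q x $ 3 $ 1 = 0 \<and> Q x $ 2 $ 3 = 0 \<and> Q x $ 3 $ 2 = 0"
      using entries[OF x(1)] Q11[OF x(1)] x(2,3) by (simp add: c_def e_def)
  qed
  have frame0: "constant_eigenframe Q U" if "U \<subseteq> \<Omega>" "\<And>x. x \<in> U \<Longrightarrow> d x = 0 \<and> e x = 0" for U
    by (rule frame[of U "\<lambda>_. 0" 0]) (use that in auto)
  have frame_prop: "constant_eigenframe Q U"
    if U: "U \<subseteq> \<Omega>" and de: "\<And>x. x \<in> U \<Longrightarrow> d x = \<alpha> * c x \<and> e x = \<beta> * c x" and ab: "\<alpha>\<^sup>2 + \<beta>\<^sup>2 = 9/4" for U \<alpha> \<beta>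
  proof -
    have "(2/3 * \<alpha>)\<^sup>2 + (2/3 * \<beta>)\<^sup>2 = 1" using ab by (simp add: power2_eq_square field_simps)
    then obtain s where "2/3 * \<alpha> = cos s" "2/3 * \<beta> = sin s" by (rule sincos_total_2pi)
    then have "\<alpha> = 3/2 * cos (2 * (s/2))" "\<beta> = 3/2 * sin (2 * (s/2))" by auto
    then show ?thesis
      by (intro frame[of U "\<lambda>x. 3/2 * c x" "s/2"] U) (simp add: de)
  qed
  have oZ: "open {x \<in> \<Omega>. Q x \<noteq> 0}"
  proof -
    have "{x \<in> \<Omega>. Q x \<noteq> 0} = \<Omega> \<inter> (\<lambda>x. (c x, d x, e x)) -` (- {(0, 0, 0)})"
      using Q0 by (auto simp: c_def d_def e_def)
    moreover have "open (\<Omega> \<inter> (\<lambda>x. (c x, d x, e x)) -` (- {(0, 0, 0)}))"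
      by (intro continuous_open_preimage assms(2) continuous_on_Pair cc open_Compl closed_singleton)
    ultimately show ?thesis by simp
  qed
  have comp: "(\<forall>x\<in>C. d x = 0 \<and> e x = 0) \<or>
     (\<exists>\<alpha> \<beta>. \<alpha>\<^sup>2 + \<beta>\<^sup>2 = 9/4 \<and> (\<forall>x\<in>C. d x = \<alpha> * c x \<and> e x = \<beta> * c x))"
    if C: "C \<in> components {x \<in> \<Omega>. Q x \<noteq> 0}" for C
  proof -
    have sub: "C \<subseteq> \<Omega>" "\<And>x. x \<in> C \<Longrightarrow> Q x \<noteq> 0" using in_components_subset[OF C] by auto
    have conn: "connected C" and ne: "C \<noteq> {}" and op: "open C"
      using C oZ in_components_connected in_components_nonempty open_components by blast+
    \<comment> \<open>Vertical and horizontal director: two closed sets that cover \<open>C\<close>. They are disjoint,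
      because both conditions together force \<open>Q x = 0\<close>.\<close>
    define A where "A = {x \<in> C. d x = 0 \<and> e x = 0}"
    define B where "B = {x \<in> C. (d x)\<^sup>2 + (e x)\<^sup>2 = 9/4 * (c x)\<^sup>2}"
    note ccC = cc[THEN continuous_on_subset, OF sub(1)]
    have "A = C \<inter> (\<lambda>x. (d x, e x)) -` {(0, 0)}" by (auto simp: A_def)
    then have cA: "closedin (top_of_set C) A"
      by (simp add: continuous_closedin_preimage ccC continuous_on_Pair)
    have "B = C \<inter> (\<lambda>x. (d x)\<^sup>2 + (e x)\<^sup>2 - 9/4 * (c x)\<^sup>2) -` {0}" by (auto simp: B_def)
    moreover have "closedin (top_of_set C) (C \<inter> (\<lambda>x. (d x)\<^sup>2 + (e x)\<^sup>2 - 9/4 * (c x)\<^sup>2) -` {0})"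
      by (intro continuous_closedin_preimage continuous_intros ccC) auto
    ultimately have cB: "closedin (top_of_set C) B" by simp
    have "A \<union> B = C" using dich sub by (auto simp: A_def B_def)
    moreover have "A \<inter> B = {}"
    proof -
      have False if "x \<in> A" "x \<in> B" for x
        using that sub Q0[of x] by (auto simp: A_def B_def)
      then show ?thesis by auto
    qed
    ultimately consider "A = {}" | "B = {}"
      using conn cA cB unfolding connected_closedin_eq by blast
    then show ?thesis
    proof cases
      case 1
      then have B: "(d x)\<^sup>2 + (e x)\<^sup>2 = 9/4 * (c x)\<^sup>2" if "x \<in> C" for x
        using that \<open>A \<union> B = C\<close> by (auto simp: B_def)
      have c0: "c x \<noteq> 0" if "x \<in> C" for x
      proof
        assume "c x = 0"
        then have "(d x)\<^sup>2 + (e x)\<^sup>2 = 0" using B[OF that] by simp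
        then have "d x = 0" "e x = 0" by (auto simp: sum_power2_eq_zero_iff)
        then show False using Q0[of x] \<open>c x = 0\<close> sub that by auto
      qed
      obtain \<alpha> \<beta> where ab: "\<forall>x\<in>C. d x = \<alpha> * c x \<and> e x = \<beta> * c x"
        using proportional_on_connected[OF op conn C2_on_subset[OF C2c sub(1)] C2_on_subset[OF C2d sub(1)]
            C2_on_subset[OF C2e sub(1)] _ _ _ B _ c0, of V] eqc eqd eqe B sub(1) by (auto simp: subset_iff)
      obtain x where x: "x \<in> C" using ne by auto
      have "(\<alpha>\<^sup>2 + \<beta>\<^sup>2) * (c x)\<^sup>2 = 9/4 * (c x)\<^sup>2"
        using B[OF x] ab x by (simp add: power_mult_distrib distrib_right)
      then have "\<alpha>\<^sup>2 + \<beta>\<^sup>2 = 9/4" using c0[OF x] by (simp only: mult_cancel_right) simp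
      with ab show ?thesis by blast
    next
      case 2
      then show ?thesis using \<open>A \<union> B = C\<close> by (auto simp: A_def)
    qed
  qed
  have "constant_eigenframe Q C" if C: "C \<in> components {x \<in> \<Omega>. Q x \<noteq> 0}" for C
  proof -
    have "C \<subseteq> \<Omega>" using in_components_subset[OF C] by auto
    then show ?thesis using comp[OF C] frame0[of C] frame_prop[of C] by blast
  qed
  moreover have "constant_eigenframe Q \<Omega>" if conn: "connected \<Omega>"
  proof (cases "\<exists>C \<in> components {x \<in> \<Omega>. Q x \<noteq> 0}. \<forall>x\<in>C. d x = 0 \<and> e x = 0")
    case True
    then obtain C where C: "C \<in> components {x \<in> \<Omega>. Q x \<noteq> 0}" "\<forall>x\<in>C. d x = 0 \<and> e x = 0" by blast
    have "open C" "C \<noteq> {}" "C \<subseteq> \<Omega>"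
      using C oZ in_components_nonempty open_components in_components_subset by blast+
    \<comment> \<open>One component with vertical director: \<open>d\<close> and \<open>e\<close> vanish on an open set.\<close>
    then show ?thesis
      using weak_unique_continuation[OF assms(2) conn C2d cV eqd, of C]
        weak_unique_continuation[OF assms(2) conn C2e cV eqe, of C] C(2)
      by (intro frame0) auto
  next
    case no_vertical: False
    show ?thesis
    proof (cases "components {x \<in> \<Omega>. Q x \<noteq> 0} = {}")
      case True
      then have "Q x = 0" if "x \<in> \<Omega>" for x using that by auto
      then show ?thesis by (intro frame0) (auto simp: d_def e_def)
    next
      case False
      then obtain C where C: "C \<in> components {x \<in> \<Omega>. Q x \<noteq> 0}" by blast
      have Cp: "open C" "C \<noteq> {}" "C \<subseteq> \<Omega>"
        using C oZ in_components_nonempty open_components in_components_subset by blast+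
      obtain \<alpha> \<beta> where ab: "\<alpha>\<^sup>2 + \<beta>\<^sup>2 = 9/4" "\<And>x. x \<in> C \<Longrightarrow> d x = \<alpha> * c x \<and> e x = \<beta> * c x"
        using comp[OF C] no_vertical C by blast
      \<comment> \<open>No component has a vertical director, so the constraint holds throughout and \<open>c\<close> solves
        the same equation as \<open>d\<close> and \<open>e\<close>; the ratios found on \<open>C\<close> extend to \<open>\<Omega>\<close>.\<close>
      have cone: "(d x)\<^sup>2 + (e x)\<^sup>2 = 9/4 * (c x)\<^sup>2" if x: "x \<in> \<Omega>" for x
      proof (cases "Q x = 0")
        case True
        then show ?thesis by (simp add: c_def d_def e_def)
      next
        case False
        then obtain C' where C': "C' \<in> components {x \<in> \<Omega>. Q x \<noteq> 0}" "x \<in> C'"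
          using x Union_components[of "{x \<in> \<Omega>. Q x \<noteq> 0}"] by blast
        then obtain \<alpha>' \<beta>' where ab': "\<alpha>'\<^sup>2 + \<beta>'\<^sup>2 = 9/4" "d x = \<alpha>' * c x" "e x = \<beta>' * c x"
          using comp[OF C'(1)] no_vertical by blast
        then have "(d x)\<^sup>2 + (e x)\<^sup>2 = (\<alpha>'\<^sup>2 + \<beta>'\<^sup>2) * (c x)\<^sup>2"
          by (simp add: power_mult_distrib distrib_right)
        then show ?thesis using ab' by simp
      qed
      have eqc': "lin_trace (H 3 3 x) = V x * c x" if "x \<in> \<Omega>" for x
        using eqc[OF that cone[OF that]] .
      have zero: "1 * f x + - \<gamma> * c x = 0"
        if f: "C2_on \<Omega> f gf Hf" "\<And>x. x \<in> \<Omega> \<Longrightarrow> lin_trace (Hf x) = V x * f x"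
          and fC: "\<And>x. x \<in> C \<Longrightarrow> f x = \<gamma> * c x" and x: "x \<in> \<Omega>" for f gf Hf \<gamma> x
        by (rule weak_unique_continuation[OF assms(2) conn C2_on_lincomb[OF f(1) C2c] cV _ Cp _ x])
           (simp_all add: fC f(2) eqc' lin_trace_add lin_trace_diff lin_trace_scaleR algebra_simps)
      show ?thesis
        using zero[OF C2d eqd, of \<alpha>] zero[OF C2e eqe, of \<beta>] ab
        by (intro frame_prop[of \<Omega> \<alpha> \<beta>]) auto
    qed
  qed
  ultimately show ?thesis by blast
qed

end
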